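(* Let $n\ge6$ be an integer, let $\varphi\in\left(\frac{\pi}{4},\frac{\pi}{2}\right)$ be the angle with $\cos\varphi=\dfrac{2n-11}{2n-5}\cdot\dfrac{\sqrt{2n-3}}{\sqrt{5(n-3)}}$, and let $$ t_1=-\frac{n-3}{2(2n-1)}-\frac{\sqrt{5(n-3)}}{(2n-1)\sqrt{2n-3}}\cos\left(\frac{\varphi}{3}-\frac{\pi}{3}\right). $$ Then $t_1$ is a point of global maximum on $\left[-\frac14;0\right]$ of the polynomial $f_{n,5}(t)$, and hence of $A^2_{n,5}$ considered as a function of $t=a^2-a$, $a\in[0;1]$.
   Context: For integers $n\ge1$, $0\le k\le n-1$ and $a\in[0;1]$, $A_{n,k}(a):=\sup\{|f^{(k)}(a)| : f\in \mathring{W}_2^n[0;1],\ \int_0^1|f^{(n)}(x)|^2dx\le 1\}$ and $A^2_{n,k}(a)=(A_{n,k}(a))^2$. Here $\mathring{W}_2^n[0;1]$ is the space of functions $f$ on $[0;1]$ whose derivatives up to order $n-1$ are absolutely continuous, with $f^{(n)}\in L_2[0;1]$ and $f^{(j)}(0)=f^{(j)}(1)=0$ for $j=0,\dots,n-1$. The value $A^2_{n,5}(a)$ depends only on $t=a^2-a\in\left[-\frac14;0\right]$ and is a polynomial in $t$; $f_{n,5}$ is the polynomial in $t$ defined by $f_{n,5}(a^2-a)=A^2_{n,5}(a)\cdot((n-3)!)^2(2n-11)$. *)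

theory Defs
  imports "HOL-Analysis.Analysis" "HOL-Computational_Algebra.Polynomial"
begin

definition abs_cont_on :: "real \<Rightarrow> real \<Rightarrow> (real \<Rightarrow> real) \<Rightarrow> bool" where
  "abs_cont_on a b f \<longleftrightarrow>
    (\<forall>\<epsilon>>0. \<exists>\<delta>>0. \<forall>(m::nat) u v.
       (\<forall>i<m. a \<le> u i \<and> u i < v i \<and> v i \<le> b) \<and>
       disjoint_family_on (\<lambda>i. {u i<..<v i}) {..<m} \<and>
       (\<Sum>i<m. v i - u i) < \<delta>
       \<longrightarrow> (\<Sum>i<m. \<bar>f (v i) - f (u i)\<bar>) < \<epsilon>)"

(* Derivatives are taken within [0,1], so they are one-sided at the endpoints and the
   values of f outside [0,1] play no role. At points where no derivative exists the
   value is an unspecified constant. *)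
definition deriv01 :: "nat \<Rightarrow> (real \<Rightarrow> real) \<Rightarrow> real \<Rightarrow> real" where
  "deriv01 k f = ((\<lambda>g x. vector_derivative g (at x within {0..1})) ^^ k) f"

(* The derivatives of order up to n - 1 exist everywhere on [0,1]; the n-th one only
   almost everywhere. *)
definition sobolev0 :: "nat \<Rightarrow> (real \<Rightarrow> real) set" where
  "sobolev0 n = {f.
     (\<forall>j. j + 1 < n \<longrightarrow> (\<forall>x\<in>{0..1}. deriv01 j f differentiable (at x within {0..1}))) \<and>
     (\<forall>j<n. abs_cont_on 0 1 (deriv01 j f)) \<and>
     (AE x in lebesgue_on {0..1}. deriv01 (n - 1) f differentiable (at x within {0..1})) \<and>
     deriv01 n f \<in> borel_measurable (lebesgue_on {0..1}) \<and>
     integrable (lebesgue_on {0..1}) (\<lambda>x. \<bar>deriv01 n f x\<bar>\<^sup>2) \<and>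
     (\<forall>j<n. deriv01 j f 0 = 0 \<and> deriv01 j f 1 = 0)}"

definition A_const :: "nat \<Rightarrow> nat \<Rightarrow> real \<Rightarrow> real" where
  "A_const n k a = Sup {\<bar>deriv01 k f a\<bar> | f.
     f \<in> sobolev0 n \<and> (LINT x|lebesgue_on {0..1}. \<bar>deriv01 n f x\<bar>\<^sup>2) \<le> 1}"

definition f_poly5 :: "nat \<Rightarrow> real poly" where
  "f_poly5 n = (THE p. \<forall>a\<in>{0..1}.
     poly p (a\<^sup>2 - a) = (A_const n 5 a)\<^sup>2 * (fact (n - 3))\<^sup>2 * (2 * real n - 11))"

end

theory Submission
  imports Defs
begin

text \<open>By Taylor's formula \<open>f\<^sup>(\<^sup>k\<^sup>)(a)\<close> is the inner product of \<open>f\<^sup>(\<^sup>n\<^sup>)\<close> with the truncated power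
  \<open>(a - x)\<^sub>+ ^ (p - 1) / (p - 1)!\<close>, \<open>p = n - k\<close>, and \<open>f\<^sup>(\<^sup>n\<^sup>)\<close> ranges over the functions orthogonal to the
  polynomials of degree below \<open>n\<close>; so \<open>A\<^sub>n\<^sub>,\<^sub>k(a)\<close> is the \<open>L\<^sub>2\<close>-distance of the truncated power to these
  polynomials. For \<open>n = p\<close> the squared distance is \<open>(a - a\<^sup>2) ^ (2 * p - 1)\<close> up to a constant, and each
  further degree \<open>m\<close> subtracts the square of a derivative of \<open>(x\<^sup>2 - x) ^ m\<close> of order \<open>m - p\<close>, taken at \<open>a\<close>.
  For \<open>k = 5\<close> the derivative in \<open>t\<close> of the result is a power of \<open>- t\<close> times \<open>- c q\<close>, where the cubic \<open>c\<close> and the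
  quadratic \<open>q\<close> are Gegenbauer polynomials and \<open>q\<close> is a combination of \<open>c\<close> and \<open>t c'\<close>. A Sonin-type
  argument then compares the local maxima, and \<open>t\<^sub>1\<close> is the smallest root of \<open>c\<close>.\<close>

section \<open>Absolutely continuous functions\<close>

text \<open>That the derivative in \<open>t\<close> factors is due to telescoping. Let I(p, m) be
  the moment of the truncated power against the Legendre polynomial L_m. For p > 1 its derivative in
  \<open>a\<close> is I(p - 1, m), and L_(m+1)' - L_(m-1)' = 2 (2 m + 1) L_m makes 2 (2 m + 1) I(p,
  m) equal to I(p - 1, m + 1) - I(p - 1, m - 1). So the derivative of the sum of (2 m + 1) I(p, m)^2
  telescopes, and for n = p + 5 what survives is the product of the moments I(p - 1, m) with m = p +
  4 and m = p + 5; the quadratic and the cubic are their nontrivial factors. This is only the origin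
  of the identity: the proof expands the squared distance and checks the factorisation as an
  identity in p and t. On the analytic side, the derivative of order n - 1 is differentiable only
  almost everywhere. Integration by parts therefore rests on the fundamental theorem for absolutely
  continuous functions, proved here for the gauge integral, where integrability of the derivative is
  part of the conclusion.\<close>

lemma abs_cont_on_finite_family:
  assumes "abs_cont_on a b G" "e > 0"
  shows "\<exists>d>0. \<forall>(T::'i set) u v. finite T \<and> (\<forall>i\<in>T. a \<le> u i \<and> u i < v i \<and> v i \<le> b) \<and>
       disjoint_family_on (\<lambda>i. {u i<..<v i}) T \<and> (\<Sum>i\<in>T. v i - u i) < d
      \<longrightarrow> (\<Sum>i\<in>T. \<bar>G (v i) - G (u i)\<bar>) < e"
proof -
  obtain d where d: "d > 0"
    "\<forall>(m::nat) u v. (\<forall>i<m. a \<le> u i \<and> u i < v i \<and> v i \<le> b) \<and>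
       disjoint_family_on (\<lambda>i. {u i<..<v i}) {..<m} \<and> (\<Sum>i<m. v i - u i) < d
      \<longrightarrow> (\<Sum>i<m. \<bar>G (v i) - G (u i)\<bar>) < e"
    using assms(1)[unfolded abs_cont_on_def, rule_format, OF assms(2)] by blast
  show ?thesis
  proof (intro exI[of _ d] conjI d(1) allI impI; elim conjE)
    fix T :: "'i set" and u v
    assume T: "finite T" "\<forall>i\<in>T. a \<le> u i \<and> u i < v i \<and> v i \<le> b"
      and disj: "disjoint_family_on (\<lambda>i. {u i<..<v i}) T" and s: "(\<Sum>i\<in>T. v i - u i) < d"
    \<comment> \<open>The definition numbers the intervals by naturals, whereas those of a tagged
      division are indexed by a set of pairs; the bijection translates.\<close>
    obtain h where h: "bij_betw h {..<card T} T"
      using ex_bij_betw_nat_finite[OF T(1)] by (auto simp: atLeast0LessThan)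
    have "(\<Sum>i<card T. \<bar>G (v (h i)) - G (u (h i))\<bar>) < e"
    proof (rule d(2)[rule_format], intro conjI)
      show "\<forall>i<card T. a \<le> u (h i) \<and> u (h i) < v (h i) \<and> v (h i) \<le> b"
        using T(2) bij_betwE[OF h] by auto
      show "disjoint_family_on (\<lambda>i. {u (h i)<..<v (h i)}) {..<card T}"
        unfolding disjoint_family_on_def
      proof (intro ballI impI)
        fix i j assume "i \<in> {..<card T}" "j \<in> {..<card T}" "i \<noteq> j"
        then have "h i \<in> T" "h j \<in> T" "h i \<noteq> h j"
          using h by (auto simp: bij_betw_def inj_on_def)
        then show "{u (h i)<..<v (h i)} \<inter> {u (h j)<..<v (h j)} = {}"
          using disj unfolding disjoint_family_on_def by metis
      qed
      show "(\<Sum>i<card T. v (h i) - u (h i)) < d"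
        using s sum.reindex_bij_betw[OF h, of "\<lambda>i. v i - u i"] by simp
    qed
    then show "(\<Sum>i\<in>T. \<bar>G (v i) - G (u i)\<bar>) < e"
      using sum.reindex_bij_betw[OF h, of "\<lambda>i. \<bar>G (v i) - G (u i)\<bar>"] by simp
  qed
qed

lemma negligible_outer_open:
  fixes N :: "'a::euclidean_space set"
  assumes "negligible N" "d > 0"
  obtains U where "open U" "N \<subseteq> U" "emeasure lebesgue U < ennreal d"
proof -
  have N: "N \<in> null_sets lebesgue"
    using assms(1) by (simp add: negligible_iff_null_sets)
  obtain U where U: "open U" "N \<subseteq> U" "emeasure lebesgue (U - N) < ennreal d"
    by (rule sets_lebesgue_outer_open[of N d]) (use N assms(2) in auto)
  have "emeasure lebesgue (U - N) = emeasure lebesgue U"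
    using emeasure_Diff_null_set[of N lebesgue U] N U(1) by (simp add: borel_open)
  with U that show thesis by auto
qed

text \<open>On tags outside \<open>N\<close> the usual Riemann-sum estimate applies; the intervals with tag in \<open>N\<close>
  lie in an open set of small measure, where absolute continuity bounds the increments of \<open>G\<close>.\<close>

theorem abs_cont_on_has_integral_derivative:
  fixes G g :: "real \<Rightarrow> real"
  assumes "a \<le> b" and AC: "abs_cont_on a b G" and neg: "negligible N"
    and der: "\<And>x. x \<in> {a..b} - N \<Longrightarrow> (G has_vector_derivative g x) (at x within {a..b})"
  shows "(g has_integral (G b - G a)) {a..b}"
proof -
  \<comment> \<open>Nothing bounds \<open>g\<close> on \<open>N\<close>. With the value 0 there, a
    tag in \<open>N\<close> contributes only the increment of \<open>G\<close>.\<close>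
  define g0 where "g0 x = (if x \<in> N then 0 else g x)" for x
  have "(g0 has_integral (G b - G a)) {a..b}"
    unfolding box_real[symmetric] has_integral
  proof (intro allI impI)
    fix e :: real assume e: "e > 0"
    define \<eta> where "\<eta> = e / (2 * (b - a + 1))"
    have \<eta>: "\<eta> > 0" using e \<open>a \<le> b\<close> by (simp add: \<eta>_def)
    have \<eta>e: "\<eta> * (b - a) \<le> e / 2"
      using e \<open>a \<le> b\<close> by (simp add: \<eta>_def field_simps)
    obtain \<delta> where \<delta>: "\<delta> > 0"
      and small: "\<forall>(T::(real \<times> real set) set) u v. finite T \<and>
         (\<forall>i\<in>T. a \<le> u i \<and> u i < v i \<and> v i \<le> b) \<and>
         disjoint_family_on (\<lambda>i. {u i<..<v i}) T \<and> (\<Sum>i\<in>T. v i - u i) < \<delta>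
        \<longrightarrow> (\<Sum>i\<in>T. \<bar>G (v i) - G (u i)\<bar>) < e / 2"
      using abs_cont_on_finite_family[where 'i = "real \<times> real set", OF AC half_gt_zero[OF e]] by blast
    obtain U where U: "open U" "N \<subseteq> U" "emeasure lebesgue U < ennreal \<delta>"
      using negligible_outer_open[OF neg \<delta>] by blast
    have "\<exists>d>0. (x \<in> {a..b} - N \<longrightarrow>
         (\<forall>y\<in>{a..b}. \<bar>y - x\<bar> < d \<longrightarrow> \<bar>G y - G x - (y-x) * g x\<bar> \<le> \<eta> * \<bar>y-x\<bar>))
         \<and> (x \<in> N \<longrightarrow> ball x d \<subseteq> U)" for x
    proof (cases "x \<in> N")
      case True
      then show ?thesis using U(1,2) by (meson DiffD2 open_contains_ball subsetD)
    next
      case False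
      then show ?thesis
      proof (cases "x \<in> {a..b}")
        case True
        then have "\<exists>d>0. \<forall>y\<in>{a..b}. norm (y - x) < d \<longrightarrow>
            norm (G y - G x - (y - x) *\<^sub>R g x) \<le> \<eta> * norm (y - x)"
          using der[of x] False \<eta> unfolding has_vector_derivative_def has_derivative_within_alt by blast
        then show ?thesis using False by auto
      qed (use False in \<open>auto intro: exI[of _ 1]\<close>)
    qed
    then obtain d where d: "\<And>x. d x > 0"
      "\<And>x y. \<lbrakk>x \<in> {a..b} - N; y \<in> {a..b}; \<bar>y - x\<bar> < d x\<rbrakk> \<Longrightarrow> \<bar>G y - G x - (y-x) * g x\<bar> \<le> \<eta> * \<bar>y-x\<bar>"
      "\<And>x. x \<in> N \<Longrightarrow> ball x (d x) \<subseteq> U"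
      by metis
    show "\<exists>\<gamma>. gauge \<gamma> \<and> (\<forall>p. p tagged_division_of cbox a b \<and> \<gamma> fine p \<longrightarrow>
       norm ((\<Sum>(x, K)\<in>p. measure lborel K *\<^sub>R g0 x) - (G b - G a)) < e)"
    proof (rule exI, safe)
      show "gauge (\<lambda>x. ball x (d x))"
        using d(1) gauge_ball_dependent by blast
    next
      fix p
      assume pt: "p tagged_division_of cbox a b" and fp: "(\<lambda>x. ball x (d x)) fine p"
      have fin: "finite p" by (rule tagged_division_ofD(1)[OF pt])
      have ivl: "\<exists>u v. K = {u..v} \<and> u \<le> v \<and> a \<le> u \<and> v \<le> b \<and> x \<in> {u..v} \<and> Sup K = v \<and> Inf K = u
          \<and> measure lborel K = v - u \<and> interior K = {u<..<v}" if xK: "(x,K) \<in> p" for x K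
      proof -
        obtain u v where K: "K = cbox u v" using tagged_division_ofD(4)[OF pt xK] by blast
        have x: "x \<in> K" "K \<subseteq> cbox a b"
          using tagged_division_ofD(2,3)[OF pt xK] by simp_all
        then have "u \<le> v" using K by auto
        then show ?thesis using x K by (intro exI[of _ u] exI[of _ v]) (auto simp: interior_atLeastAtMost_real)
      qed
      define I where "I = (\<lambda>(x::real,K). measure lborel K * g0 x - (G (Sup K) - G (Inf K)))"
      define q where "q = {xK \<in> p. fst xK \<in> N}"
      \<comment> \<open>A tagged division may contain one-point intervals, while absolute continuity
        speaks of \<open>u i < v i\<close>; the increments dropped here are 0.\<close>
      define q' where "q' = {xK \<in> p. fst xK \<in> N \<and> Inf (snd xK) < Sup (snd xK)}"
      have good: "\<bar>\<Sum>xK\<in>p - q. I xK\<bar> \<le> e / 2"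
      proof -
        have "\<bar>\<Sum>xK\<in>p - q. I xK\<bar> \<le> (\<Sum>xK\<in>p - q. \<eta> * (Sup (snd xK) - Inf (snd xK)))"
          unfolding real_norm_def[symmetric]
        proof (rule sum_norm_le, clarify)
          fix x K assume xK: "(x,K) \<in> p" "(x,K) \<notin> q"
          then have xN: "x \<notin> N" by (simp add: q_def)
          obtain u v where K: "K = {u..v}" "u \<le> v" "a \<le> u" "v \<le> b" "x \<in> {u..v}" "Sup K = v"
            "Inf K = u" "measure lborel K = v - u"
            using ivl[OF xK(1)] by blast
          have ball: "\<forall>y\<in>K. \<bar>y - x\<bar> < d x"
            using fp xK(1) by (auto simp: fine_def dist_real_def subset_iff abs_minus_commute)
          have 1: "\<bar>G u - G x - (u - x) * g x\<bar> \<le> \<eta> * \<bar>u - x\<bar>"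
            using K xN bspec[OF ball, of u] by (intro d) auto
          have 2: "\<bar>G v - G x - (v - x) * g x\<bar> \<le> \<eta> * \<bar>v - x\<bar>"
            using K xN bspec[OF ball, of v] by (intro d) auto
          \<comment> \<open>Straddling: the tag lies between \<open>u\<close> and \<open>v\<close>,
            so the error bounds on its two sides add up to a multiple of
            \<open>v - u\<close>.\<close>
          have "I (x,K) = (G u - G x - (u - x) * g x) - (G v - G x - (v - x) * g x)"
            using K xN by (simp add: I_def g0_def algebra_simps)
          then have "\<bar>I (x,K)\<bar> \<le> \<eta> * \<bar>u - x\<bar> + \<eta> * \<bar>v - x\<bar>"
            using 1 2 by linarith
          also have "\<dots> = \<eta> * (v - u)" using K(5) by (simp add: algebra_simps)
          finally show "norm (I (x,K)) \<le> \<eta> * (Sup (snd (x,K)) - Inf (snd (x,K)))"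
            using K by simp
        qed
        also have "\<dots> \<le> (\<Sum>xK\<in>p. \<eta> * (Sup (snd xK) - Inf (snd xK)))"
        proof (rule sum_mono2[OF fin])
          show "0 \<le> \<eta> * (Sup (snd xK) - Inf (snd xK))" if "xK \<in> p - (p - q)" for xK
            using ivl[of "fst xK" "snd xK"] that \<eta> by auto
        qed auto
        also have "\<dots> = \<eta> * (b - a)"
          using additive_tagged_division_1[of a b p "\<lambda>x. x"] \<open>a \<le> b\<close> pt
          by (simp add: sum_distrib_left[symmetric] case_prod_unfold)
        finally show ?thesis using \<eta>e by linarith
      qed
      have bad: "\<bar>\<Sum>xK\<in>q. I xK\<bar> < e / 2"
      proof -
        have disj: "disjoint_family_on (\<lambda>xK. {Inf (snd xK)<..<Sup (snd xK)}) q'"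
          unfolding disjoint_family_on_def
        proof (intro ballI impI)
          fix i j assume ij: "i \<in> q'" "j \<in> q'" "i \<noteq> j"
          obtain x K y L where xy: "i = (x,K)" "j = (y,L)" by fastforce
          have "interior K \<inter> interior L = {}"
            using tagged_division_ofD(5)[OF pt, of x K y L] ij xy by (simp add: q'_def)
          moreover have "interior K = {Inf K<..<Sup K}" "interior L = {Inf L<..<Sup L}"
            using ivl[of x K] ivl[of y L] ij xy unfolding q'_def by fastforce+
          ultimately show "{Inf (snd i)<..<Sup (snd i)} \<inter> {Inf (snd j)<..<Sup (snd j)} = {}"
            using xy by simp
        qed
        have fq: "finite q'" "finite q" using fin by (auto simp: q'_def q_def)
        have "emeasure lebesgue (\<Union>xK\<in>q'. {Inf (snd xK)<..<Sup (snd xK)})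
            = (\<Sum>xK\<in>q'. emeasure lebesgue {Inf (snd xK)<..<Sup (snd xK)})"
          using disj fq by (intro sum_emeasure[symmetric]) auto
        also have "\<dots> = (\<Sum>xK\<in>q'. ennreal (Sup (snd xK) - Inf (snd xK)))"
          by (intro sum.cong refl) (simp add: q'_def)
        also have "\<dots> = ennreal (\<Sum>xK\<in>q'. Sup (snd xK) - Inf (snd xK))"
          by (intro sum_ennreal) (auto simp: q'_def)
        finally have "ennreal (\<Sum>xK\<in>q'. Sup (snd xK) - Inf (snd xK))
            = emeasure lebesgue (\<Union>xK\<in>q'. {Inf (snd xK)<..<Sup (snd xK)})" ..
        also have "\<dots> \<le> emeasure lebesgue U"
        proof (rule emeasure_mono)
          show "(\<Union>xK\<in>q'. {Inf (snd xK)<..<Sup (snd xK)}) \<subseteq> U"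
          proof clarify
            fix x K y assume xK: "(x,K) \<in> q'" and y: "y \<in> {Inf (snd (x,K))<..<Sup (snd (x,K))}"
            have "y \<in> K" using ivl[of x K] xK y by (auto simp: q'_def)
            moreover have "K \<subseteq> ball x (d x)" using fp xK by (auto simp: fine_def q'_def)
            ultimately show "y \<in> U" using d(3)[of x] xK by (auto simp: q'_def)
          qed
          show "U \<in> sets lebesgue" using U(1) by (simp add: borel_open)
        qed
        also note U(3)
        finally have len: "(\<Sum>xK\<in>q'. Sup (snd xK) - Inf (snd xK)) < \<delta>"
        proof (subst (asm) ennreal_less_iff)
          show "0 \<le> (\<Sum>xK\<in>q'. Sup (snd xK) - Inf (snd xK))"
            by (intro sum_nonneg) (simp add: q'_def)
        qed
        have "(\<Sum>xK\<in>q'. \<bar>G (Sup (snd xK)) - G (Inf (snd xK))\<bar>) < e / 2"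
        proof (rule small[rule_format], intro conjI ballI fq(1) disj len)
          fix i assume "i \<in> q'"
          then have "a \<le> Inf (snd i) \<and> Inf (snd i) < Sup (snd i) \<and> Sup (snd i) \<le> b"
            using ivl[of "fst i" "snd i"] by (auto simp: q'_def)
          then show "a \<le> Inf (snd i)" "Inf (snd i) < Sup (snd i)" "Sup (snd i) \<le> b" by auto
        qed
        moreover have "\<bar>\<Sum>xK\<in>q. I xK\<bar> \<le> (\<Sum>xK\<in>q. \<bar>G (Sup (snd xK)) - G (Inf (snd xK))\<bar>)"
          unfolding real_norm_def[symmetric]
          by (rule sum_norm_le) (auto simp: I_def g0_def q_def)
        moreover have "(\<Sum>xK\<in>q. \<bar>G (Sup (snd xK)) - G (Inf (snd xK))\<bar>)
            = (\<Sum>xK\<in>q'. \<bar>G (Sup (snd xK)) - G (Inf (snd xK))\<bar>)"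
        proof (rule sum.mono_neutral_right[OF fq(2)])
          show "\<forall>i\<in>q - q'. \<bar>G (Sup (snd i)) - G (Inf (snd i))\<bar> = 0"
          proof
            fix i assume "i \<in> q - q'"
            then have "Inf (snd i) = Sup (snd i)"
              using ivl[of "fst i" "snd i"] by (auto simp: q_def q'_def)
            then show "\<bar>G (Sup (snd i)) - G (Inf (snd i))\<bar> = 0" by simp
          qed
        qed (auto simp: q_def q'_def)
        ultimately show ?thesis by linarith
      qed
      have "(\<Sum>(x, K)\<in>p. measure lborel K *\<^sub>R g0 x) - (G b - G a) = (\<Sum>xK\<in>p. I xK)"
        using additive_tagged_division_1[of a b p G] \<open>a \<le> b\<close> pt
        by (simp add: I_def sum_subtractf case_prod_unfold)
      also have "\<dots> = (\<Sum>xK\<in>p - q. I xK) + (\<Sum>xK\<in>q. I xK)"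
        using fin by (intro sum.subset_diff) (auto simp: q_def)
      finally show "norm ((\<Sum>(x, K)\<in>p. measure lborel K *\<^sub>R g0 x) - (G b - G a)) < e"
        using good bad unfolding real_norm_def by linarith
    qed
  qed
  then show ?thesis
    by (rule has_integral_spike[OF neg, rotated]) (simp add: g0_def)
qed

section \<open>Criteria for absolute continuity and its permanence properties\<close>

lemma abs_cont_on_lipschitz:
  fixes G :: "real \<Rightarrow> real"
  assumes "\<And>x y. \<lbrakk>x \<in> {a..b}; y \<in> {a..b}\<rbrakk> \<Longrightarrow> \<bar>G y - G x\<bar> \<le> C * \<bar>y - x\<bar>"
  shows "abs_cont_on a b G"
  unfolding abs_cont_on_def
proof (intro allI impI)
  fix e :: real assume e: "e > 0"
  define C' where "C' = \<bar>C\<bar> + 1"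
  have C': "C' > 0" "C \<le> C'" by (auto simp: C'_def)
  show "\<exists>\<delta>>0. \<forall>(m::nat) u v. (\<forall>i<m. a \<le> u i \<and> u i < v i \<and> v i \<le> b) \<and>
       disjoint_family_on (\<lambda>i. {u i<..<v i}) {..<m} \<and> (\<Sum>i<m. v i - u i) < \<delta>
      \<longrightarrow> (\<Sum>i<m. \<bar>G (v i) - G (u i)\<bar>) < e"
  proof (intro exI[of _ "e / C'"] conjI allI impI)
    show "e / C' > 0" using e C' by simp
    fix m :: nat and u v
    assume *: "(\<forall>i<m. a \<le> u i \<and> u i < v i \<and> v i \<le> b) \<and>
       disjoint_family_on (\<lambda>i. {u i<..<v i}) {..<m} \<and> (\<Sum>i<m. v i - u i) < e / C'"
    have "(\<Sum>i<m. \<bar>G (v i) - G (u i)\<bar>) \<le> (\<Sum>i<m. C' * (v i - u i))"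
    proof (rule sum_mono)
      fix i assume "i \<in> {..<m}"
      then have i: "a \<le> u i" "u i < v i" "v i \<le> b" using * by auto
      then have "\<bar>G (v i) - G (u i)\<bar> \<le> C * (v i - u i)"
        using assms[of "u i" "v i"] by auto
      also have "\<dots> \<le> C' * (v i - u i)"
        using i C' by (intro mult_right_mono) auto
      finally show "\<bar>G (v i) - G (u i)\<bar> \<le> C' * (v i - u i)" .
    qed
    also have "\<dots> = C' * (\<Sum>i<m. v i - u i)" by (simp add: sum_distrib_left)
    also have "\<dots> < e" using * C' by (simp add: field_simps)
    finally show "(\<Sum>i<m. \<bar>G (v i) - G (u i)\<bar>) < e" .
  qed
qed

lemma abs_cont_on_deriv_bounded:
  fixes G g :: "real \<Rightarrow> real"
  assumes "\<And>x. x \<in> {a..b} \<Longrightarrow> (G has_vector_derivative g x) (at x within {a..b})"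
    and "\<And>x. x \<in> {a..b} \<Longrightarrow> \<bar>g x\<bar> \<le> C"
  shows "abs_cont_on a b G"
proof (rule abs_cont_on_lipschitz)
  fix x y assume "x \<in> {a..b}" "y \<in> {a..b}"
  then show "\<bar>G y - G x\<bar> \<le> C * \<bar>y - x\<bar>"
    using assms field_differentiable_bound[of "{a..b}" G g C y x]
    by (simp add: has_real_derivative_iff_has_vector_derivative)
qed

lemma abs_cont_on_common:
  assumes "abs_cont_on a b F" "abs_cont_on a b G" "e1 > 0" "e2 > 0"
  shows "\<exists>\<delta>>0. \<forall>(m::nat) u v. (\<forall>i<m. a \<le> u i \<and> u i < v i \<and> v i \<le> b) \<and>
       disjoint_family_on (\<lambda>i. {u i<..<v i}) {..<m} \<and> (\<Sum>i<m. v i - u i) < \<delta>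
      \<longrightarrow> (\<Sum>i<m. \<bar>F (v i) - F (u i)\<bar>) < e1 \<and> (\<Sum>i<m. \<bar>G (v i) - G (u i)\<bar>) < e2"
proof -
  obtain d1 d2 where d: "d1 > 0" "d2 > 0"
    "\<forall>(m::nat) u v. (\<forall>i<m. a \<le> u i \<and> u i < v i \<and> v i \<le> b) \<and>
       disjoint_family_on (\<lambda>i. {u i<..<v i}) {..<m} \<and> (\<Sum>i<m. v i - u i) < d1
      \<longrightarrow> (\<Sum>i<m. \<bar>F (v i) - F (u i)\<bar>) < e1"
    "\<forall>(m::nat) u v. (\<forall>i<m. a \<le> u i \<and> u i < v i \<and> v i \<le> b) \<and>
       disjoint_family_on (\<lambda>i. {u i<..<v i}) {..<m} \<and> (\<Sum>i<m. v i - u i) < d2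
      \<longrightarrow> (\<Sum>i<m. \<bar>G (v i) - G (u i)\<bar>) < e2"
    using assms(1)[unfolded abs_cont_on_def, rule_format, OF assms(3)]
      assms(2)[unfolded abs_cont_on_def, rule_format, OF assms(4)] by blast
  show ?thesis
    by (rule exI[of _ "min d1 d2"]) (use d in auto)
qed

lemma abs_cont_on_mult:
  assumes "abs_cont_on a b F" "abs_cont_on a b G"
    and C: "\<And>x. x \<in> {a..b} \<Longrightarrow> \<bar>F x\<bar> \<le> C" "\<And>x. x \<in> {a..b} \<Longrightarrow> \<bar>G x\<bar> \<le> C"
  shows "abs_cont_on a b (\<lambda>x. F x * G x)"
  unfolding abs_cont_on_def
proof (intro allI impI)
  fix e :: real assume e: "e > 0"
  define C' where "C' = \<bar>C\<bar> + 1"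
  have C': "C' > 0" "C \<le> C'" by (auto simp: C'_def)
  define e' where "e' = e / (2 * C')"
  have e': "e' > 0" using e C' by (simp add: e'_def)
  obtain d where d: "d > 0"
    "\<forall>(m::nat) u v. (\<forall>i<m. a \<le> u i \<and> u i < v i \<and> v i \<le> b) \<and>
       disjoint_family_on (\<lambda>i. {u i<..<v i}) {..<m} \<and> (\<Sum>i<m. v i - u i) < d
      \<longrightarrow> (\<Sum>i<m. \<bar>F (v i) - F (u i)\<bar>) < e' \<and> (\<Sum>i<m. \<bar>G (v i) - G (u i)\<bar>) < e'"
    using abs_cont_on_common[OF assms(1,2) e' e'] by blast
  show "\<exists>\<delta>>0. \<forall>(m::nat) u v. (\<forall>i<m. a \<le> u i \<and> u i < v i \<and> v i \<le> b) \<and>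
       disjoint_family_on (\<lambda>i. {u i<..<v i}) {..<m} \<and> (\<Sum>i<m. v i - u i) < \<delta>
      \<longrightarrow> (\<Sum>i<m. \<bar>F (v i) * G (v i) - F (u i) * G (u i)\<bar>) < e"
  proof (intro exI[of _ d] conjI d(1) allI impI)
    fix m :: nat and u v
    assume uv: "(\<forall>i<m. a \<le> u i \<and> u i < v i \<and> v i \<le> b) \<and>
       disjoint_family_on (\<lambda>i. {u i<..<v i}) {..<m} \<and> (\<Sum>i<m. v i - u i) < d"
    then have FG: "(\<Sum>i<m. \<bar>F (v i) - F (u i)\<bar>) < e'" "(\<Sum>i<m. \<bar>G (v i) - G (u i)\<bar>) < e'"
      using d(2) by blast+
    have "(\<Sum>i<m. \<bar>F (v i) * G (v i) - F (u i) * G (u i)\<bar>)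
        \<le> (\<Sum>i<m. C' * \<bar>G (v i) - G (u i)\<bar> + C' * \<bar>F (v i) - F (u i)\<bar>)"
    proof (rule sum_mono)
      fix i assume "i \<in> {..<m}"
      then have i: "u i \<in> {a..b}" "v i \<in> {a..b}" using uv by force+
      have "F (v i) * G (v i) - F (u i) * G (u i)
          = F (v i) * (G (v i) - G (u i)) + G (u i) * (F (v i) - F (u i))"
        by (simp add: algebra_simps)
      then have "\<bar>F (v i) * G (v i) - F (u i) * G (u i)\<bar>
          \<le> \<bar>F (v i)\<bar> * \<bar>G (v i) - G (u i)\<bar> + \<bar>G (u i)\<bar> * \<bar>F (v i) - F (u i)\<bar>"
        by (simp add: abs_mult[symmetric] abs_triangle_ineq)
      also have "\<dots> \<le> C' * \<bar>G (v i) - G (u i)\<bar> + C' * \<bar>F (v i) - F (u i)\<bar>"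
        using C(1)[OF i(2)] C(2)[OF i(1)] C' by (intro add_mono mult_right_mono) auto
      finally show "\<bar>F (v i) * G (v i) - F (u i) * G (u i)\<bar>
          \<le> C' * \<bar>G (v i) - G (u i)\<bar> + C' * \<bar>F (v i) - F (u i)\<bar>" .
    qed
    also have "\<dots> = C' * ((\<Sum>i<m. \<bar>F (v i) - F (u i)\<bar>) + (\<Sum>i<m. \<bar>G (v i) - G (u i)\<bar>))"
      by (simp add: sum.distrib sum_distrib_left algebra_simps)
    also have "\<dots> < C' * (e' + e')" using FG C' by (intro mult_strict_left_mono) auto
    also have "\<dots> = e" using C' by (simp add: e'_def field_simps)
    finally show "(\<Sum>i<m. \<bar>F (v i) * G (v i) - F (u i) * G (u i)\<bar>) < e" .
  qed
qed

lemma abs_cont_on_subset: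
  assumes "abs_cont_on a b G" "a \<le> c" "d \<le> b"
  shows "abs_cont_on c d G"
  unfolding abs_cont_on_def
proof (intro allI impI)
  fix e :: real assume e: "e > 0"
  obtain \<delta> where \<delta>: "\<delta> > 0"
    "\<forall>(m::nat) u v. (\<forall>i<m. a \<le> u i \<and> u i < v i \<and> v i \<le> b) \<and>
       disjoint_family_on (\<lambda>i. {u i<..<v i}) {..<m} \<and> (\<Sum>i<m. v i - u i) < \<delta>
      \<longrightarrow> (\<Sum>i<m. \<bar>G (v i) - G (u i)\<bar>) < e"
    using assms(1)[unfolded abs_cont_on_def, rule_format, OF e] by blast
  show "\<exists>\<delta>>0. \<forall>(m::nat) u v. (\<forall>i<m. c \<le> u i \<and> u i < v i \<and> v i \<le> d) \<and>
       disjoint_family_on (\<lambda>i. {u i<..<v i}) {..<m} \<and> (\<Sum>i<m. v i - u i) < \<delta>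
      \<longrightarrow> (\<Sum>i<m. \<bar>G (v i) - G (u i)\<bar>) < e"
  proof (intro exI[of _ \<delta>] conjI \<delta>(1) allI impI)
    fix m :: nat and u v
    assume *: "(\<forall>i<m. c \<le> u i \<and> u i < v i \<and> v i \<le> d) \<and>
       disjoint_family_on (\<lambda>i. {u i<..<v i}) {..<m} \<and> (\<Sum>i<m. v i - u i) < \<delta>"
    then have "\<forall>i<m. a \<le> u i \<and> u i < v i \<and> v i \<le> b" using assms(2,3) by force
    then show "(\<Sum>i<m. \<bar>G (v i) - G (u i)\<bar>) < e" using \<delta>(2) * by blast
  qed
qed

lemma abs_cont_on_continuous:
  assumes "abs_cont_on a b G"
  shows "continuous_on {a..b} G"
proof (rule continuous_on_iff[THEN iffD2], intro ballI allI impI)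
  fix x e :: real assume x: "x \<in> {a..b}" and e: "e > 0"
  obtain \<delta> where \<delta>: "\<delta> > 0"
    "\<forall>(m::nat) u v. (\<forall>i<m. a \<le> u i \<and> u i < v i \<and> v i \<le> b) \<and>
       disjoint_family_on (\<lambda>i. {u i<..<v i}) {..<m} \<and> (\<Sum>i<m. v i - u i) < \<delta>
      \<longrightarrow> (\<Sum>i<m. \<bar>G (v i) - G (u i)\<bar>) < e"
    using assms(1)[unfolded abs_cont_on_def, rule_format, OF e] by blast
  have *: "\<bar>G z - G y\<bar> < e" if "a \<le> y" "y < z" "z \<le> b" "z - y < \<delta>" for y z
    using \<delta>(2)[rule_format, of "Suc 0" "\<lambda>_. y" "\<lambda>_. z"] that
    by (simp add: disjoint_family_on_def)
  show "\<exists>d>0. \<forall>x'\<in>{a..b}. dist x' x < d \<longrightarrow> dist (G x') (G x) < e"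
  proof (intro exI[of _ \<delta>] conjI \<delta>(1) ballI impI)
    fix y assume y: "y \<in> {a..b}" "dist y x < \<delta>"
    show "dist (G y) (G x) < e"
      using *[of x y] *[of y x] x y e
      by (cases x y rule: linorder_cases) (auto simp: dist_real_def abs_minus_commute)
  qed
qed

section \<open>Repeated integration by parts\<close>

lemma continuous_on_Icc_bounded:
  fixes G :: "real \<Rightarrow> real"
  assumes "continuous_on {a..b} G"
  obtains C where "\<And>x. x \<in> {a..b} \<Longrightarrow> \<bar>G x\<bar> \<le> C"
proof -
  have "bounded (G ` {a..b})"
    using assms by (intro compact_imp_bounded compact_continuous_image) auto
  then obtain C where "\<forall>y\<in>G ` {a..b}. norm y \<le> C" unfolding bounded_iff by blast
  then show thesis by (intro that[of C]) simp
qed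

lemma has_vector_derivative_poly:
  "(poly h has_vector_derivative poly (pderiv h) x) (at x within S)" for h :: "real poly"
  using poly_DERIV[of h x]
  by (auto simp: has_real_derivative_iff_has_vector_derivative[symmetric] intro: has_field_derivative_at_within)

lemma abs_cont_on_poly: "abs_cont_on a b (poly h)"
proof -
  obtain C where "\<And>x. x \<in> {a..b} \<Longrightarrow> \<bar>poly (pderiv h) x\<bar> \<le> C"
    by (rule continuous_on_Icc_bounded[of a b "poly (pderiv h)"]) (auto intro: continuous_intros)
  then show ?thesis
    by (intro abs_cont_on_deriv_bounded[of a b _ "poly (pderiv h)" C] has_vector_derivative_poly) auto
qed

text \<open>A common frame for the derivatives of a Sobolev function, the iterated integrals of a
  bounded function and the derivatives of a polynomial. The negligible sets accommodate the last
  differentiation of a Sobolev function.\<close>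

definition deriv_chain :: "nat \<Rightarrow> (nat \<Rightarrow> real \<Rightarrow> real) \<Rightarrow> bool" where
  "deriv_chain n F \<longleftrightarrow> (\<forall>j<n. abs_cont_on 0 1 (F j) \<and>
     (\<exists>N. negligible N \<and>
        (\<forall>x\<in>{0..1} - N. (F j has_vector_derivative F (Suc j) x) (at x within {0..1}))))"

text \<open>The product of \<open>G\<close> and \<open>h\<close> is absolutely continuous, so its
  derivative integrates to its increment. Subtracting the known integral also yields the
  integrability of \<open>g * h\<close>, without any assumption on the size of
  \<open>g\<close>.\<close>

lemma integration_by_parts_poly:
  fixes G g :: "real \<Rightarrow> real"
  assumes AC: "abs_cont_on 0 1 G" and N: "negligible N"
    and der: "\<And>x. x \<in> {0..1} - N \<Longrightarrow> (G has_vector_derivative g x) (at x within {0..1})"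
    and cd: "0 \<le> c" "c \<le> d" "d \<le> 1"
    and rest: "((\<lambda>x. G x * poly (pderiv h) x) has_integral I) {c..d}"
  shows "((\<lambda>x. g x * poly h x) has_integral (G d * poly h d - G c * poly h c - I)) {c..d}"
proof -
  obtain C1 where C1: "\<And>x. x \<in> {0..1} \<Longrightarrow> \<bar>G x\<bar> \<le> C1"
    using continuous_on_Icc_bounded[OF abs_cont_on_continuous[OF AC]] by blast
  obtain C2 where C2: "\<And>x. x \<in> {0..1} \<Longrightarrow> \<bar>poly h x\<bar> \<le> C2"
    by (rule continuous_on_Icc_bounded[of 0 1 "poly h"]) (auto intro: continuous_intros)
  have "abs_cont_on 0 1 (\<lambda>x. G x * poly h x)"
    by (rule abs_cont_on_mult[OF AC abs_cont_on_poly, where C = "max C1 C2"]) (use C1 C2 in fastforce)+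
  then have "abs_cont_on c d (\<lambda>x. G x * poly h x)"
    by (rule abs_cont_on_subset) (use cd in auto)
  then have "((\<lambda>x. G x * poly (pderiv h) x + g x * poly h x) has_integral
      (G d * poly h d - G c * poly h c)) {c..d}"
  proof (rule abs_cont_on_has_integral_derivative[OF cd(2) _ N])
    fix x assume "x \<in> {c..d} - N"
    then have "(G has_vector_derivative g x) (at x within {c..d})"
      using der[of x] cd by (auto intro: has_vector_derivative_within_subset)
    then show "((\<lambda>x. G x * poly h x) has_vector_derivative
        G x * poly (pderiv h) x + g x * poly h x) (at x within {c..d})"
      by (rule has_vector_derivative_mult[OF _ has_vector_derivative_poly])
  qed
  from has_integral_diff[OF this rest] show ?thesis by simp
qed

text \<open>Each step moves one derivative from \<open>F\<close> to \<open>h\<close>. After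
  \<open>n\<close> steps the remaining integrand contains \<open>(pderiv ^^ n) h = 0\<close>, so
  only boundary terms are left.\<close>

theorem deriv_chain_integration_by_parts:
  assumes "deriv_chain n F" "0 \<le> c" "c \<le> d" "d \<le> 1" "(pderiv ^^ n) h = 0"
  shows "((\<lambda>x. F n x * poly h x) has_integral
    (\<Sum>j<n. (-1) ^ j * (F (n - 1 - j) d * poly ((pderiv ^^ j) h) d
                        - F (n - 1 - j) c * poly ((pderiv ^^ j) h) c))) {c..d}"
  using assms(1,5)
proof (induction n arbitrary: h)
  case 0
  then show ?case by simp
next
  case (Suc n)
  obtain N where N: "negligible N" "abs_cont_on 0 1 (F n)"
      "\<forall>x\<in>{0..1} - N. (F n has_vector_derivative F (Suc n) x) (at x within {0..1})"
    using Suc.prems(1) by (auto simp: deriv_chain_def)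
  have "deriv_chain n F" using Suc.prems(1) by (simp add: deriv_chain_def)
  moreover have "(pderiv ^^ n) (pderiv h) = 0"
    using Suc.prems(2) by (simp add: funpow_Suc_right del: funpow.simps)
  ultimately have IH: "((\<lambda>x. F n x * poly (pderiv h) x) has_integral
      (\<Sum>j<n. (-1) ^ j * (F (n - 1 - j) d * poly ((pderiv ^^ j) (pderiv h)) d
                        - F (n - 1 - j) c * poly ((pderiv ^^ j) (pderiv h)) c))) {c..d}"
    (is "(_ has_integral ?I) _") by (rule Suc.IH)
  have "(\<Sum>j<Suc n. (-1) ^ j * (F (Suc n - 1 - j) d * poly ((pderiv ^^ j) h) d
                        - F (Suc n - 1 - j) c * poly ((pderiv ^^ j) h) c))
      = F n d * poly h d - F n c * poly h c - ?I"
  proof -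
    have "(\<Sum>j<n. (-1) ^ Suc j * (F (Suc n - 1 - Suc j) d * poly ((pderiv ^^ Suc j) h) d
                        - F (Suc n - 1 - Suc j) c * poly ((pderiv ^^ Suc j) h) c)) = - ?I"
      unfolding sum_negf[symmetric]
      by (intro sum.cong refl) (simp add: funpow_Suc_right del: funpow.simps)
    then show ?thesis unfolding sum.lessThan_Suc_shift by simp
  qed
  with integration_by_parts_poly[OF N(2,1) N(3)[rule_format] assms(2-4) IH]
  show ?case by simp
qed

text \<open>The cofactor has to be carried along with its value at \<open>c\<close> for the
  induction; this covers at once the vanishing below order \<open>m\<close> and the value at order
  \<open>m\<close>.\<close>

lemma higher_pderiv_root_power:
  fixes q :: "real poly"
  assumes "j \<le> m"
  shows "\<exists>r. (pderiv ^^ j) ([:-c, 1:] ^ m * q) = [:-c, 1:] ^ (m - j) * r \<and>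
             poly r c = fact m / fact (m - j) * poly q c"
  using assms
proof (induction j)
  case 0
  then show ?case by (intro exI[of _ q]) simp
next
  case (Suc j)
  then obtain r where r: "(pderiv ^^ j) ([:-c, 1:] ^ m * q) = [:-c, 1:] ^ (m - j) * r"
    "poly r c = fact m / fact (m - j) * poly q c" by auto
  obtain k where k: "m - j = Suc k" using Suc.prems by (metis Suc_diff_Suc Suc_le_lessD)
  then have k': "m - Suc j = k" by simp
  have "pderiv ([:-c, 1:] ^ Suc k * r) = [:-c, 1:] ^ k * (smult (of_nat (Suc k)) r + [:-c, 1:] * pderiv r)"
    unfolding pderiv_mult pderiv_power_Suc by (simp add: pderiv_pCons algebra_simps)
  moreover have "poly (smult (of_nat (Suc k)) r + [:-c, 1:] * pderiv r) c = fact m / fact k * poly q c"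
    using r(2) unfolding k by (simp add: fact_Suc del: of_nat_Suc)
  ultimately show ?case using r(1) unfolding k k' by auto
qed

lemma poly_higher_pderiv_root_power:
  fixes q :: "real poly"
  assumes "j \<le> m"
  shows "poly ((pderiv ^^ j) ([:-c, 1:] ^ m * q)) c = (if j = m then fact m * poly q c else 0)"
  using higher_pderiv_root_power[OF assms, of c q] assms by auto

lemma degree_higher_pderiv_eq_0:
  fixes h :: "real poly"
  assumes "degree h < n" shows "(pderiv ^^ n) h = 0"
  using assms
proof (induction n arbitrary: h)
  case (Suc n)
  have "pderiv h = 0 \<or> degree (pderiv h) < n"
    using Suc.prems by (cases "degree h") (auto simp: degree_pderiv pderiv_eq_0_iff)
  then show ?case using Suc.IH[of "pderiv h"]
    by (auto simp: funpow_Suc_right simp del: funpow.simps)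
qed simp

lemma deriv_chain_orthogonal_poly:
  assumes "deriv_chain n F" "\<And>j. j < n \<Longrightarrow> F j 0 = 0" "\<And>j. j < n \<Longrightarrow> F j 1 = 0" "degree h < n"
  shows "((\<lambda>x. F n x * poly h x) has_integral 0) {0..1}"
  using deriv_chain_integration_by_parts[OF assms(1) _ _ _ degree_higher_pderiv_eq_0[OF assms(4)], of 0 1]
    assms(2,3,4) by simp

text \<open>For \<open>p = 1\<close> this is a step function with a jump at \<open>a\<close>, which
  is why later statements exclude the point \<open>a\<close>.\<close>

definition cut_power :: "nat \<Rightarrow> real \<Rightarrow> real \<Rightarrow> real" where
  "cut_power p a x = (if x < a then (a - x) ^ (p - 1) / fact (p - 1) else 0)"

text \<open>Taylor's formula with integral remainder: \<open>cut_power p a\<close> represents the evaluation of the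
  derivative of order \<open>n - p\<close> at \<open>a\<close>.\<close>

lemma deriv_chain_cut_power:
  assumes F: "deriv_chain n F" "\<And>j. j < n \<Longrightarrow> F j 0 = 0" and p: "0 < p" "p \<le> n"
    and a: "a \<in> {0..1}"
  shows "((\<lambda>x. F n x * cut_power p a x) has_integral F (n - p) a) {0..1}"
proof -
  \<comment> \<open>Written as a power of \<open>x - a\<close> with cofactor 1 to fit
    \<open>poly_higher_pderiv_root_power\<close>: at \<open>a\<close> only the derivative of order
    \<open>p - 1\<close> survives, and its partner in the boundary term is
    \<open>F (n - p) a\<close>.\<close>
  define h where "h = smult ((-1) ^ (p - 1) / fact (p - 1)) ([:-a, 1:] ^ (p - 1) * 1)"
  have deg: "degree h = p - 1" by (simp add: h_def degree_power_eq)
  have ph: "poly h x = (a - x) ^ (p - 1) / fact (p - 1)" for x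
    by (simp add: h_def power_mult_distrib[symmetric])
  have Dh: "poly ((pderiv ^^ j) h) a = (if j = p - 1 then (-1) ^ (p - 1) else 0)" for j
  proof (cases "j \<le> p - 1")
    case True
    then show ?thesis
      unfolding h_def higher_pderiv_smult poly_smult poly_higher_pderiv_root_power[OF True] by auto
  next
    case False
    then show ?thesis using degree_higher_pderiv_eq_0[of h j] deg by auto
  qed
  have "((\<lambda>x. F n x * poly h x) has_integral
    (\<Sum>j<n. (-1) ^ j * (F (n - 1 - j) a * poly ((pderiv ^^ j) h) a
                        - F (n - 1 - j) 0 * poly ((pderiv ^^ j) h) 0))) {0..a}"
    using a deg p by (intro deriv_chain_integration_by_parts F degree_higher_pderiv_eq_0) auto
  also have "(\<Sum>j<n. (-1) ^ j * (F (n - 1 - j) a * poly ((pderiv ^^ j) h) a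
                        - F (n - 1 - j) 0 * poly ((pderiv ^^ j) h) 0))
      = (\<Sum>j<n. if j = p - 1 then F (n - p) a else 0)"
    by (intro sum.cong refl)
      (use p F(2) in \<open>auto simp: Dh power_mult_distrib[symmetric] simp flip: power_add mult_2\<close>)
  also have "\<dots> = F (n - p) a" using p by simp
  finally have 1: "((\<lambda>x. F n x * poly h x) has_integral F (n - p) a) {0..a}" .
  have 2: "((\<lambda>x. F n x * cut_power p a x) has_integral F (n - p) a) {0..a}"
    by (rule has_integral_spike[OF negligible_sing _ 1, of a]) (auto simp: cut_power_def ph)
  have "((\<lambda>x. F n x * cut_power p a x) has_integral 0) {a..1}"
    by (rule has_integral_is_0) (simp add: cut_power_def)
  from has_integral_combine[OF _ _ 2 this] a show ?thesis by simp
qed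

section \<open>Square integrable functions on the unit interval\<close>

definition sq_integrable :: "(real \<Rightarrow> real) \<Rightarrow> bool" where
  "sq_integrable u \<longleftrightarrow> u \<in> borel_measurable (lebesgue_on {0..1}) \<and>
     integrable (lebesgue_on {0..1}) (\<lambda>x. (u x)\<^sup>2)"

definition ip :: "(real \<Rightarrow> real) \<Rightarrow> (real \<Rightarrow> real) \<Rightarrow> real" where
  "ip u v = (LINT x|lebesgue_on {0..1}. u x * v x)"

lemma sq_integrable_mult:
  assumes "sq_integrable u" "sq_integrable v"
  shows "integrable (lebesgue_on {0..1}) (\<lambda>x. u x * v x)"
proof (rule Bochner_Integration.integrable_bound)
  show "integrable (lebesgue_on {0..1}) (\<lambda>x. (u x)\<^sup>2 + (v x)\<^sup>2)"
    using assms by (auto simp: sq_integrable_def)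
  show "(\<lambda>x. u x * v x) \<in> borel_measurable (lebesgue_on {0..1})"
    using assms by (auto simp: sq_integrable_def)
  have "\<bar>u x * v x\<bar> \<le> (u x)\<^sup>2 + (v x)\<^sup>2" for x
  proof -
    have "2 * (\<bar>u x\<bar> * \<bar>v x\<bar>) \<le> (u x)\<^sup>2 + (v x)\<^sup>2"
      using sum_squares_bound[of "\<bar>u x\<bar>" "\<bar>v x\<bar>"] by (simp add: mult.assoc)
    moreover have "\<bar>u x\<bar> * \<bar>v x\<bar> \<ge> 0" by simp
    ultimately show ?thesis unfolding abs_mult by linarith
  qed
  then show "AE x in lebesgue_on {0..1}. norm (u x * v x) \<le> norm ((u x)\<^sup>2 + (v x)\<^sup>2)"
    by simp
qed

lemma sq_integrable_add [intro]:
  assumes "sq_integrable u" "sq_integrable v"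
  shows "sq_integrable (\<lambda>x. u x + v x)"
proof -
  have "integrable (lebesgue_on {0..1}) (\<lambda>x. (u x)\<^sup>2 + (v x)\<^sup>2 + 2 * (u x * v x))"
    using assms sq_integrable_mult[OF assms] by (auto simp: sq_integrable_def)
  then show ?thesis
    using assms by (auto simp: sq_integrable_def power2_sum algebra_simps)
qed

lemma sq_integrable_scale [intro]: "sq_integrable u \<Longrightarrow> sq_integrable (\<lambda>x. c * u x)"
  by (auto simp: sq_integrable_def power_mult_distrib)

lemma sq_integrable_diff [intro]:
  assumes "sq_integrable u" "sq_integrable v"
  shows "sq_integrable (\<lambda>x. u x - v x)"
  using sq_integrable_add[OF assms(1) sq_integrable_scale[OF assms(2), of "-1"]] by simp

lemma sq_integrable_bounded:
  assumes "u \<in> borel_measurable (lebesgue_on {0..1})" "\<And>x. x \<in> {0..1} \<Longrightarrow> \<bar>u x\<bar> \<le> C"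
  shows "sq_integrable u"
proof -
  interpret finite_measure "lebesgue_on {0..1::real}"
    by (rule finite_measure_lebesgue_on) simp
  have "(u x)\<^sup>2 \<le> C\<^sup>2" if "x \<in> {0..1}" for x
    using assms(2)[OF that] by (metis abs_ge_zero power2_abs power_mono)
  then have "integrable (lebesgue_on {0..1}) (\<lambda>x. (u x)\<^sup>2)"
    using assms(1) by (intro integrable_const_bound[of _ "C\<^sup>2"] AE_I2) auto
  with assms(1) show ?thesis by (simp add: sq_integrable_def)
qed

lemma sq_integrable_continuous:
  assumes "continuous_on {0..1} u"
  shows "sq_integrable u"
  using continuous_on_Icc_bounded[OF assms]
    sq_integrable_bounded[OF continuous_imp_measurable_on_sets_lebesgue[OF assms]]
  by (metis lmeasurable_interval(1) fmeasurableD cbox_interval)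

lemma sq_integrable_poly [intro]: "sq_integrable (poly h)"
  by (intro sq_integrable_continuous continuous_intros)

lemma cut_power_bounded:
  assumes "x \<in> {0..1}" "a \<in> {0..1}" shows "\<bar>cut_power p a x\<bar> \<le> 1"
proof -
  have "(a - x) ^ (p - 1) / fact (p - 1) \<le> 1 / 1" if "x < a"
    using assms that by (intro frac_le power_le_one) auto
  then show ?thesis using assms by (auto simp: cut_power_def abs_if divide_less_0_iff zero_less_power)
qed

lemma sq_integrable_cut_power [intro]:
  assumes "a \<in> {0..1}" shows "sq_integrable (cut_power p a)"
proof (rule sq_integrable_bounded[OF _ cut_power_bounded[OF _ assms]])
  have "cut_power p a \<in> borel_measurable borel"
    unfolding cut_power_def by measurable
  then show "cut_power p a \<in> borel_measurable (lebesgue_on {0..1})"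
    by (intro measurable_restrict_space1 measurable_completion) simp
qed

lemma ip_commute: "ip u v = ip v u"
  by (simp add: ip_def mult.commute)

lemma ip_add:
  assumes "sq_integrable u" "sq_integrable v" "sq_integrable w"
  shows "ip (\<lambda>x. u x + v x) w = ip u w + ip v w"
  using sq_integrable_mult[OF assms(1,3)] sq_integrable_mult[OF assms(2,3)]
  by (simp add: ip_def distrib_right)

lemma ip_diff:
  assumes "sq_integrable u" "sq_integrable v" "sq_integrable w"
  shows "ip (\<lambda>x. u x - v x) w = ip u w - ip v w"
  using sq_integrable_mult[OF assms(1,3)] sq_integrable_mult[OF assms(2,3)]
  by (simp add: ip_def left_diff_distrib)

lemma ip_scale: "ip (\<lambda>x. c * u x) w = c * ip u w"
  by (simp add: ip_def mult.assoc)

lemma ip_nonneg: "ip u u \<ge> 0"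
  by (simp add: ip_def)

lemma sq_integrable_sum [intro]:
  "(\<And>i. i \<in> I \<Longrightarrow> sq_integrable (u i)) \<Longrightarrow> sq_integrable (\<lambda>x. \<Sum>i\<in>I. u i x)"
proof (induction I rule: infinite_finite_induct)
  case (insert i I)
  then show ?case by simp (intro sq_integrable_add; simp)
qed (use sq_integrable_poly[of 0] in \<open>simp_all add: sq_integrable_def\<close>)

lemma ip_sum:
  assumes "finite I" "\<And>i. i \<in> I \<Longrightarrow> sq_integrable (u i)" "sq_integrable w"
  shows "ip (\<lambda>x. \<Sum>i\<in>I. u i x) w = (\<Sum>i\<in>I. ip (u i) w)"
  using assms
proof (induction I rule: finite_induct)
  case (insert i I)
  then show ?case
    using ip_add[of "u i" "\<lambda>x. \<Sum>i\<in>I. u i x" w] sq_integrable_sum[of I u] by simp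
qed (simp add: ip_def)

lemma has_integral_ip:
  assumes "sq_integrable u" "sq_integrable v"
  shows "((\<lambda>x. u x * v x) has_integral ip u v) {0..1}"
  unfolding ip_def using sq_integrable_mult[OF assms]
  by (rule has_integral_integral_lebesgue_on) simp

text \<open>Integrals are computed as gauge integrals, while \<open>ip\<close> is a Lebesgue
  integral; for square integrable factors the two agree.\<close>

lemma ip_eqI:
  assumes "((\<lambda>x. u x * v x) has_integral I) {0..1}" "sq_integrable u" "sq_integrable v"
  shows "ip u v = I"
  using has_integral_unique[OF has_integral_ip[OF assms(2,3)] assms(1)] .

lemma ip_Cauchy_Schwarz:
  assumes "sq_integrable u" "sq_integrable v"
  shows "(ip u v)\<^sup>2 \<le> ip u u * ip v v"
proof -
  have quad: "ip u u - 2 * s * ip u v + s\<^sup>2 * ip v v \<ge> 0" for s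
  proof -
    have sv: "sq_integrable (\<lambda>x. s * v x)" using assms(2) by (rule sq_integrable_scale)
    have expand: "ip (\<lambda>x. u x - s * v x) z = ip u z - s * ip v z" if "sq_integrable z" for z
      using ip_diff[OF assms(1) sv that] by (simp only: ip_scale)
    have "0 \<le> ip (\<lambda>x. u x - s * v x) (\<lambda>x. u x - s * v x)" by (rule ip_nonneg)
    also have "\<dots> = ip u (\<lambda>x. u x - s * v x) - s * ip v (\<lambda>x. u x - s * v x)"
      by (rule expand[OF sq_integrable_diff[OF assms(1) sv]])
    also have "\<dots> = ip (\<lambda>x. u x - s * v x) u - s * ip (\<lambda>x. u x - s * v x) v"
      by (simp only: ip_commute)
    also have "\<dots> = ip u u - s * ip v u - s * (ip u v - s * ip v v)"
      by (simp only: expand assms)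
    also have "\<dots> = ip u u - 2 * s * ip u v + s\<^sup>2 * ip v v"
      by (simp only: ip_commute[of v u] power2_eq_square) (simp add: algebra_simps)
    finally show ?thesis .
  qed
  show ?thesis
  proof (cases "ip v v = 0")
    case True
    \<comment> \<open>The quadratic is now linear in \<open>s\<close>; for
      \<open>ip u v \<noteq> 0\<close> the chosen \<open>s\<close> would give it the value
      -1.\<close>
    have "ip u v = 0"
      using quad[of "(ip u u + 1) / (2 * ip u v)"] True by (cases "ip u v = 0") auto
    then show ?thesis using True by simp
  next
    case False
    then have "ip v v > 0" using ip_nonneg[of v] by simp
    then show ?thesis
      using quad[of "ip u v / ip v v"] by (simp add: field_simps power2_eq_square)
  qed
qed

section \<open>Legendre polynomials and the distance to polynomials\<close>

lemma ip_smult: "ip (poly (smult c h)) u = c * ip (poly h) u"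
  by (simp add: ip_def mult.assoc)

lemma deriv_chain_higher_pderiv: "deriv_chain n (\<lambda>j. poly ((pderiv ^^ j) q))"
  unfolding deriv_chain_def
  by (intro allI impI conjI abs_cont_on_poly exI[of _ "{}"]) (simp_all add: has_vector_derivative_poly)

abbreviation parabola :: "real poly" where "parabola \<equiv> [:0, -1, 1:]"

text \<open>Rodrigues' formula for the Legendre polynomials shifted to \<open>{0..1}\<close>,
  normalised to the value 1 at 1.\<close>

definition legendre :: "nat \<Rightarrow> real poly" where
  "legendre m = smult (1 / fact m) ((pderiv ^^ m) (parabola ^ m))"

text \<open>The form \<open>[:- 0, 1:]\<close> matches the pattern \<open>[:-c, 1:]\<close> of the
  lemmas on multiple roots.\<close>

lemma parabola_power: "parabola ^ m = [:- 0, 1:] ^ m * [:- 1, 1:] ^ m"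
  "parabola ^ m = [:- 1, 1:] ^ m * [:- 0, 1:] ^ m"
  by (simp_all add: power_mult_distrib[symmetric])

lemma higher_pderiv_parabola_roots:
  assumes "j < m"
  shows "poly ((pderiv ^^ j) (parabola ^ m)) 0 = 0" "poly ((pderiv ^^ j) (parabola ^ m)) 1 = 0"
proof -
  show "poly ((pderiv ^^ j) (parabola ^ m)) 0 = 0"
    unfolding parabola_power(1) using assms by (subst poly_higher_pderiv_root_power) auto
  show "poly ((pderiv ^^ j) (parabola ^ m)) 1 = 0"
    unfolding parabola_power(2) using assms by (subst poly_higher_pderiv_root_power) auto
qed

lemma poly_legendre_1: "poly (legendre m) 1 = 1"
  unfolding legendre_def parabola_power(2) poly_smult
  by (subst poly_higher_pderiv_root_power) auto

lemma degree_legendre: "degree (legendre m) = m"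
proof -
  have "degree (parabola ^ m) = m * 2" by (subst degree_power_eq) auto
  then show ?thesis by (simp add: legendre_def degree_higher_pderiv)
qed

lemma legendre_orthogonal_poly:
  assumes "degree h < m" shows "ip (poly (legendre m)) (poly h) = 0"
proof -
  have "((\<lambda>x. poly ((pderiv ^^ m) (parabola ^ m)) x * poly h x) has_integral 0) {0..1}"
    using deriv_chain_orthogonal_poly[OF deriv_chain_higher_pderiv _ _ assms, of "parabola ^ m"]
      higher_pderiv_parabola_roots[of _ m] by blast
  from has_integral_mult_right[OF this, of "1 / fact m"]
  show ?thesis
    by (intro ip_eqI) (auto simp: legendre_def mult.assoc)
qed

lemma legendre_orthogonal: "l \<noteq> m \<Longrightarrow> ip (poly (legendre l)) (poly (legendre m)) = 0"
  using legendre_orthogonal_poly[of "legendre l" m] legendre_orthogonal_poly[of "legendre m" l]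
  by (cases l m rule: linorder_cases) (auto simp: degree_legendre ip_commute)

lemma lead_coeff_legendre: "coeff (legendre m) m \<noteq> 0"
  using poly_legendre_1[of m] degree_legendre[of m] by (metis leading_coeff_0_iff poly_0 zero_neq_one)

text \<open>The integral of \<open>(x L\<^sup>2)'\<close> is \<open>L(1)\<^sup>2 = 1\<close>, and \<open>x L' - m L\<close> has degree below \<open>m\<close>.\<close>

lemma ip_legendre: "ip (poly (legendre m)) (poly (legendre m)) = 1 / (2 * real m + 1)"
proof -
  let ?L = "legendre m"
  define r where "r = [:0, 1:] * pderiv ?L - smult (real m) ?L"
  have r: "degree r < m \<or> r = 0"
  proof (rule ccontr)
    assume *: "\<not> (degree r < m \<or> r = 0)"
    have "degree ([:0, 1:] * pderiv ?L) \<le> m"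
      using degree_mult_le[of "[:0, 1:]" "pderiv ?L"]
      by (cases m) (auto simp: degree_pderiv degree_legendre pderiv_eq_0_iff[THEN iffD2])
    then have "degree r \<le> m"
      unfolding r_def by (intro degree_diff_le) (simp_all add: degree_legendre)
    with * have "degree r = m" "r \<noteq> 0" by auto
    moreover have "coeff r m = 0"
      by (cases m) (simp_all add: r_def coeff_pderiv)
    ultimately show False by (metis leading_coeff_0_iff)
  qed
  have "((\<lambda>x. poly (pderiv ([:0, 1:] * ?L * ?L)) x) has_integral
      (poly ([:0, 1:] * ?L * ?L) 1 - poly ([:0, 1:] * ?L * ?L) 0)) {0..1}"
    by (rule fundamental_theorem_of_calculus[OF _ has_vector_derivative_poly]) simp
  also have "(\<lambda>x. poly (pderiv ([:0, 1:] * ?L * ?L)) x)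
      = (\<lambda>x. poly ?L x * (poly (smult (2 * real m + 1) ?L) x + poly (smult 2 r) x))"
    by (simp add: r_def pderiv_mult pderiv_pCons algebra_simps)
  finally have "ip (poly ?L) (\<lambda>x. poly (smult (2 * real m + 1) ?L) x + poly (smult 2 r) x) = 1"
    by (intro ip_eqI sq_integrable_add sq_integrable_poly) (simp add: poly_legendre_1)
  moreover have "ip (poly ?L) (\<lambda>x. poly (smult (2 * real m + 1) ?L) x + poly (smult 2 r) x)
      = (2 * real m + 1) * ip (poly ?L) (poly ?L) + 2 * ip (poly r) (poly ?L)"
    unfolding ip_commute[of "poly ?L" "\<lambda>x. poly (smult (2 * real m + 1) ?L) x + poly (smult 2 r) x"]
    by (subst ip_add) (auto simp: ip_smult)
  moreover have "ip (poly r) (poly ?L) = 0"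
    using r legendre_orthogonal_poly[of r m] by (auto simp: ip_commute ip_def)
  ultimately show ?thesis by (simp add: field_simps)
qed

text \<open>Since \<open>legendre n\<close> has degree exactly \<open>n\<close>, subtracting a
  multiple of it removes the leading term of \<open>h\<close>.\<close>

lemma orthogonal_poly_if_orthogonal_legendre:
  assumes u: "sq_integrable u" "\<And>m. m < n \<Longrightarrow> ip u (poly (legendre m)) = 0" and "degree h < n"
  shows "ip u (poly h) = 0"
  using assms(2,3)
proof (induction n arbitrary: h)
  case (Suc n)
  define c where "c = coeff h n / coeff (legendre n) n"
  define g where "g = h - smult c (legendre n)"
  have "degree g \<le> n"
    unfolding g_def using Suc.prems(2) by (intro degree_diff_le) (auto simp: degree_legendre)
  moreover have "coeff g n = 0" using lead_coeff_legendre[of n] by (simp add: g_def c_def)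
  ultimately have "degree g < n \<or> g = 0"
    by (metis leading_coeff_0_iff le_neq_implies_less)
  then have "ip u (poly g) = 0"
    using Suc.IH[of g] Suc.prems(1) by (auto simp: ip_def)
  moreover have "poly h = (\<lambda>x. poly g x + c * poly (legendre n) x)"
    by (simp add: g_def fun_eq_iff)
  ultimately show ?case
    using ip_add[of "poly g" "\<lambda>x. c * poly (legendre n) x" u] Suc.prems(1)[of n] u(1)
    by (simp add: ip_commute[of u] ip_scale sq_integrable_scale sq_integrable_poly)
qed simp

text \<open>The factor \<open>2 * real m + 1\<close> is the inverse of the squared norm of
  \<open>legendre m\<close>, so this is the orthogonal projection of \<open>cut_power p a\<close>
  onto degree below \<open>n\<close>.\<close>

definition proj_poly :: "nat \<Rightarrow> nat \<Rightarrow> real \<Rightarrow> real poly" where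
  "proj_poly n p a = (\<Sum>m<n. smult ((2 * real m + 1) * ip (cut_power p a) (poly (legendre m))) (legendre m))"

definition resid :: "nat \<Rightarrow> nat \<Rightarrow> real \<Rightarrow> real \<Rightarrow> real" where
  "resid n p a x = cut_power p a x - poly (proj_poly n p a) x"

lemma degree_proj_poly: "0 < n \<Longrightarrow> degree (proj_poly n p a) < n"
  unfolding proj_poly_def
  by (rule degree_sum_less) (auto intro: le_less_trans[OF degree_smult_le] simp: degree_legendre)

lemma ip_proj_poly:
  assumes "sq_integrable u"
  shows "ip (poly (proj_poly n p a)) u
    = (\<Sum>m<n. (2 * real m + 1) * ip (cut_power p a) (poly (legendre m)) * ip (poly (legendre m)) u)"
proof -
  have "poly (proj_poly n p a)
      = (\<lambda>x. \<Sum>m<n. (2 * real m + 1) * ip (cut_power p a) (poly (legendre m)) * poly (legendre m) x)"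
    by (simp add: proj_poly_def poly_sum fun_eq_iff)
  then show ?thesis
    using ip_sum[of "{..<n}" "\<lambda>m x. (2 * real m + 1) * ip (cut_power p a) (poly (legendre m)) * poly (legendre m) x" u]
      assms by (simp add: ip_scale sq_integrable_scale sq_integrable_poly)
qed

lemma sq_integrable_resid: "a \<in> {0..1} \<Longrightarrow> sq_integrable (resid n p a)"
  unfolding resid_def by (intro sq_integrable_diff sq_integrable_cut_power sq_integrable_poly)

lemma ip_resid:
  assumes "a \<in> {0..1}" "sq_integrable u"
  shows "ip (resid n p a) u = ip (cut_power p a) u - ip (poly (proj_poly n p a)) u"
  unfolding resid_def using assms by (intro ip_diff) auto

lemma resid_orthogonal_poly:
  assumes a: "a \<in> {0..1}" and "degree h < n"
  shows "ip (resid n p a) (poly h) = 0"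
proof (rule orthogonal_poly_if_orthogonal_legendre[OF sq_integrable_resid[OF a] _ assms(2)])
  fix m assume m: "m < n"
  have "ip (poly (proj_poly n p a)) (poly (legendre m))
      = (\<Sum>l<n. if l = m then ip (cut_power p a) (poly (legendre m)) else 0)"
    unfolding ip_proj_poly[OF sq_integrable_poly]
  proof (intro sum.cong refl)
    fix l
    have "2 * real m + 1 \<noteq> 0" by linarith
    then show "(2 * real l + 1) * ip (cut_power p a) (poly (legendre l)) * ip (poly (legendre l)) (poly (legendre m))
        = (if l = m then ip (cut_power p a) (poly (legendre m)) else 0)"
      by (simp add: legendre_orthogonal ip_legendre)
  qed
  also have "\<dots> = ip (cut_power p a) (poly (legendre m))" using m by simp
  finally show "ip (resid n p a) (poly (legendre m)) = 0"
    using a by (simp add: ip_resid sq_integrable_poly)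
qed

definition sq_dist :: "nat \<Rightarrow> nat \<Rightarrow> real \<Rightarrow> real" where
  "sq_dist n p a = ip (resid n p a) (resid n p a)"

lemma sq_dist_eq_ip_cut_power:
  assumes "a \<in> {0..1}" "0 < n"
  shows "ip (resid n p a) (cut_power p a) = sq_dist n p a"
proof -
  have "ip (resid n p a) (resid n p a) = ip (cut_power p a) (resid n p a) - ip (poly (proj_poly n p a)) (resid n p a)"
    by (rule ip_resid[OF assms(1) sq_integrable_resid[OF assms(1)]])
  then show ?thesis
    using resid_orthogonal_poly[OF assms(1) degree_proj_poly[OF assms(2)]]
    by (simp add: ip_commute sq_dist_def)
qed

lemma sq_dist_eq:
  assumes "a \<in> {0..1}" "0 < n"
  shows "sq_dist n p a = ip (cut_power p a) (cut_power p a)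
           - (\<Sum>m<n. (2 * real m + 1) * (ip (cut_power p a) (poly (legendre m)))\<^sup>2)"
  using sq_dist_eq_ip_cut_power[OF assms, of p] ip_resid[OF assms(1) sq_integrable_cut_power[OF assms(1)], of n p p]
    ip_proj_poly[OF sq_integrable_cut_power[OF assms(1)], of n p a p]
  by (simp add: ip_commute[of "poly _"] power2_eq_square mult.assoc)

lemma sq_dist_minimal:
  assumes a: "a \<in> {0..1}" and "degree q < n"
  shows "sq_dist n p a \<le> ip (\<lambda>x. cut_power p a x - poly q x) (\<lambda>x. cut_power p a x - poly q x)"
proof -
  define g where "g = proj_poly n p a - q"
  let ?w = "resid n p a"
  have g: "degree g < n"
    unfolding g_def using assms(2) degree_proj_poly[of n p a] by (intro degree_diff_less) auto
  have sw: "sq_integrable ?w" and sg: "sq_integrable (poly g)"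
    using a by (auto intro: sq_integrable_resid)
  then have swg: "sq_integrable (\<lambda>x. ?w x + poly g x)" by blast
  have "(\<lambda>x. cut_power p a x - poly q x) = (\<lambda>x. ?w x + poly g x)"
    by (simp add: resid_def g_def fun_eq_iff)
  moreover have "ip (\<lambda>x. ?w x + poly g x) (\<lambda>x. ?w x + poly g x)
      = ip (\<lambda>x. ?w x + poly g x) ?w + ip (\<lambda>x. ?w x + poly g x) (poly g)"
    using ip_add[OF sw sg swg] by (simp only: ip_commute)
  moreover have "\<dots> = sq_dist n p a + ip (poly g) (poly g)"
    using ip_add[OF sw sg sw] ip_add[OF sw sg sg] resid_orthogonal_poly[OF a g, of p]
    by (simp add: sq_dist_def ip_commute[of "poly g" ?w])
  ultimately show ?thesis using ip_nonneg[of "poly g"] by simp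
qed

section \<open>Symmetry of the squared distance under reflection of the interval\<close>

lemma has_integral_reflect_01:
  fixes f :: "real \<Rightarrow> real"
  assumes "(f has_integral I) {0..1}"
  shows "((\<lambda>x. f (1 - x)) has_integral I) {0..1}"
proof -
  have "((\<lambda>x. f (-1 *\<^sub>R x + 1)) has_integral (1 / \<bar>-1\<bar> ^ DIM(real)) *\<^sub>R I)
      ((\<lambda>x. (1 / -1) *\<^sub>R x + - ((1 / -1) *\<^sub>R 1)) ` cbox 0 1)"
    using assms by (intro has_integral_affinity) auto
  moreover have "(\<lambda>x::real. (1 / -1) *\<^sub>R x + - ((1 / -1) *\<^sub>R 1)) ` cbox 0 1 = {0..1}"
    by (auto simp: image_iff intro: bexI[of _ "1 - _"])
  ultimately show ?thesis by simp
qed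

text \<open>The substitution of \<open>1 - x\<close> for \<open>x\<close> turns
  \<open>cut_power p a\<close> into \<open>(-1) ^ p * cut_power p (1 - a)\<close> plus a polynomial
  of degree below \<open>p\<close>, so the reflected best approximation competes at
  \<open>1 - a\<close>. An inequality is enough, since the reflection is an involution.\<close>

lemma sq_dist_reflect_le:
  assumes a: "a \<in> {0..1}" and "0 < p"
  shows "sq_dist p p (1 - a) \<le> sq_dist p p a"
proof -
  \<comment> \<open>\<open>H\<close> continues the nonzero branch of the truncated power across
    \<open>a\<close>; subtracting it exchanges the side on which the truncated power
    vanishes.\<close>
  define H where "H = smult (1 / fact (p - 1)) ([:a, -1:] ^ (p - 1))"
  define q where "q = smult ((-1) ^ (p - 1)) ((H - proj_poly p p a) \<circ>\<^sub>p [:1, -1:])"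
  have "degree H < p" using assms(2) by (simp add: H_def degree_power_eq)
  then have "degree (H - proj_poly p p a) < p"
    using degree_proj_poly[OF assms(2)] by (intro degree_diff_less) auto
  then have q: "degree q < p" by (simp add: q_def degree_pcompose)
  let ?u = "\<lambda>x. cut_power p (1 - a) x - poly q x"
  have u: "?u x = (-1) ^ p * resid p p a (1 - x)" if "x \<noteq> 1 - a" for x
  proof -
    obtain k where k: "p = Suc k" using assms(2) gr0_implies_Suc by blast
    have neg: "(a - (1 - x)) ^ k = (-1) ^ k * (1 - a - x) ^ k"
      by (simp add: power_mult_distrib[symmetric] algebra_simps)
    have pq: "poly q x = (-1) ^ k * ((a - (1 - x)) ^ k / fact k - poly (proj_poly p p a) (1 - x))"
      by (simp add: q_def H_def poly_pcompose k) (simp add: algebra_simps)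
    show ?thesis
    proof (cases "x < 1 - a")
      case True
      then have "resid p p a (1 - x) = - poly (proj_poly p p a) (1 - x)"
        by (simp add: resid_def cut_power_def)
      moreover have "(-1) ^ k * ((-1) ^ k * (1 - a - x) ^ k) = (1 - a - x) ^ k"
        by (simp add: mult.assoc[symmetric] power_mult_distrib[symmetric])
      ultimately show ?thesis
        using True by (simp add: pq neg cut_power_def k right_diff_distrib)
    next
      case False
      with that have "1 - x < a" by simp
      then have "resid p p a (1 - x) = (a - (1 - x)) ^ k / fact k - poly (proj_poly p p a) (1 - x)"
        by (simp add: resid_def cut_power_def k)
      then show ?thesis using False by (simp add: pq cut_power_def k)
    qed
  qed
  have su: "sq_integrable ?u"
    by (intro sq_integrable_diff sq_integrable_poly sq_integrable_cut_power) (use a in auto)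
  have "((\<lambda>x. resid p p a (1 - x) * resid p p a (1 - x)) has_integral sq_dist p p a) {0..1}"
    unfolding sq_dist_def
    by (rule has_integral_reflect_01) (intro has_integral_ip sq_integrable_resid a)
  then have "((\<lambda>x. ?u x * ?u x) has_integral sq_dist p p a) {0..1}"
    by (rule has_integral_spike[OF negligible_sing[of "1 - a"], rotated])
      (use u in \<open>simp add: power_mult_distrib[symmetric]\<close>)
  then have "ip ?u ?u = sq_dist p p a" by (rule ip_eqI[OF _ su su])
  moreover have "sq_dist p p (1 - a) \<le> ip ?u ?u"
    using a q by (intro sq_dist_minimal) auto
  ultimately show ?thesis by simp
qed

lemma sq_dist_reflect:
  assumes "a \<in> {0..1}" "0 < p"
  shows "sq_dist p p (1 - a) = sq_dist p p a"
  using sq_dist_reflect_le[of a p] sq_dist_reflect_le[of "1 - a" p] assms by auto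

section \<open>Norm and moments of the truncated powers\<close>

lemma ip_cut_power_cut_power:
  assumes a: "a \<in> {0..1}" and p: "0 < p"
  shows "ip (cut_power p a) (cut_power p a) = a ^ (2 * p - 1) / ((2 * real p - 1) * (fact (p - 1))\<^sup>2)"
proof -
  obtain k where k: "p = Suc k" using p gr0_implies_Suc by blast
  define I where "I = a ^ (2 * k + 1) / ((2 * real k + 1) * (fact k)\<^sup>2)"
  have nz: "2 * real k + 1 \<noteq> 0" by linarith
  define C where "C = (2 * real k + 1) * (fact k)\<^sup>2"
  have der: "((\<lambda>x. - ((a - x) ^ (2 * k + 1)) / C) has_vector_derivative ((a - x) ^ k / fact k)\<^sup>2)
      (at x within {0..a})" for x
  proof -
    have "((\<lambda>x. (a - x) ^ Suc (2 * k)) has_real_derivative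
        (1 + real (2 * k)) * (-1 * (a - x) ^ (2 * k))) (at x within {0..a})"
      by (intro DERIV_power_Suc) (auto intro!: derivative_eq_intros)
    from DERIV_cmult[OF this, of "-1 / C"]
    have "((\<lambda>x. - ((a - x) ^ (2 * k + 1)) / C) has_real_derivative
        (2 * real k + 1) * (a - x) ^ (2 * k) / C) (at x within {0..a})"
      by (simp add: algebra_simps add_divide_distrib diff_divide_distrib)
    moreover have "(2 * real k + 1) * (a - x) ^ (2 * k) / C = ((a - x) ^ k / fact k)\<^sup>2"
      using nz by (simp add: C_def power_divide power_mult[symmetric] mult.commute[of k 2])
    ultimately show ?thesis by (simp only: has_real_derivative_iff_has_vector_derivative)
  qed
  have "((\<lambda>x. ((a - x) ^ k / fact k)\<^sup>2) has_integral
      (- ((a - a) ^ (2 * k + 1)) / C - (- ((a - 0) ^ (2 * k + 1)) / C))) {0..a}"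
    using a by (intro fundamental_theorem_of_calculus der) auto
  then have 1: "((\<lambda>x. ((a - x) ^ k / fact k)\<^sup>2) has_integral I) {0..a}" by (simp add: I_def C_def)
  have 2: "((\<lambda>x. cut_power p a x * cut_power p a x) has_integral I) {0..a}"
    by (rule has_integral_spike[OF negligible_sing _ 1, of a])
      (auto simp: cut_power_def k power2_eq_square)
  have "((\<lambda>x. cut_power p a x * cut_power p a x) has_integral 0) {a..1}"
    by (rule has_integral_is_0) (simp add: cut_power_def)
  from has_integral_combine[OF _ _ 2 this] a
  have "((\<lambda>x. cut_power p a x * cut_power p a x) has_integral I) {0..1}" by simp
  then have "ip (cut_power p a) (cut_power p a) = I" using a by (intro ip_eqI) auto
  then show ?thesis by (simp add: I_def k)
qed

text \<open>Up to \<open>fact m\<close>, the Legendre polynomial is the \<open>p\<close>-th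
  derivative of \<open>(pderiv ^^ (m - p)) (parabola ^ m)\<close>, whose derivatives of order below
  \<open>p\<close> vanish at 0. Pairing with the truncated power undoes these \<open>p\<close>
  derivatives and evaluates at \<open>a\<close>.\<close>

lemma ip_cut_power_legendre_ge:
  assumes a: "a \<in> {0..1}" and p: "0 < p" "p \<le> m"
  shows "ip (cut_power p a) (poly (legendre m)) = poly ((pderiv ^^ (m - p)) (parabola ^ m)) a / fact m"
proof -
  let ?q = "(pderiv ^^ (m - p)) (parabola ^ m)"
  have *: "(pderiv ^^ j) ?q = (pderiv ^^ (m - p + j)) (parabola ^ m)" for j
    by (simp add: funpow_add[symmetric] add.commute flip: comp_apply[of "pderiv ^^ j"])
  have "((\<lambda>x. poly ((pderiv ^^ p) ?q) x * cut_power p a x) has_integral poly ((pderiv ^^ (p - p)) ?q) a) {0..1}"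
    using p a higher_pderiv_parabola_roots(1)[of "m - p + _" m]
    by (intro deriv_chain_cut_power deriv_chain_higher_pderiv) (auto simp: *)
  from has_integral_mult_right[OF this, of "1 / fact m"]
  have "((\<lambda>x. cut_power p a x * poly (legendre m) x) has_integral poly ?q a / fact m) {0..1}"
    using p by (simp add: * legendre_def mult_ac)
  then show ?thesis using a by (intro ip_eqI) auto
qed

lemma higher_antiderivative:
  fixes L :: "real poly"
  obtains S where "degree S \<le> degree L" "(pderiv ^^ p) ([:-0, 1:] ^ p * S) = L"
proof
  \<comment> \<open>The \<open>p\<close>-th derivative of \<open>x ^ (i + p)\<close> is
    \<open>pochhammer (i + 1) p * x ^ i\<close>.\<close>
  define S where "S = (\<Sum>i\<le>degree L. monom (coeff L i / pochhammer (real (Suc i)) p) i)"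
  have cS: "coeff S i = coeff L i / pochhammer (real (Suc i)) p" for i
    by (simp add: S_def coeff_sum coeff_eq_0)
  show "degree S \<le> degree L" by (intro degree_le) (simp add: cS coeff_eq_0)
  have "pochhammer (real (Suc i)) p \<noteq> 0" for i
    using pochhammer_pos[of "real (Suc i)" p] by simp
  then show "(pderiv ^^ p) ([:-0, 1:] ^ p * S) = L"
    by (intro poly_eqI) (simp add: coeff_higher_pderiv cS monom_altdef[of 1, simplified, symmetric]
        coeff_monom_mult)
qed

text \<open>For degrees below \<open>p\<close> the moments are not evaluated: the factor
  \<open>a ^ p\<close> and the degree bound are all that \<open>sq_dist_self\<close> uses of
  them.\<close>

lemma ip_cut_power_poly:
  assumes p: "0 < p"
  obtains S where "degree S \<le> degree L"
    "\<And>a. a \<in> {0..1} \<Longrightarrow> ip (cut_power p a) (poly L) = a ^ p * poly S a"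
proof -
  obtain S where S: "degree S \<le> degree L" "(pderiv ^^ p) ([:-0, 1:] ^ p * S) = L"
    by (rule higher_antiderivative)
  show thesis
  proof (rule that[OF S(1)])
    fix a :: real assume a: "a \<in> {0..1}"
    have "((\<lambda>x. poly ((pderiv ^^ p) ([:-0, 1:] ^ p * S)) x * cut_power p a x) has_integral
        poly ((pderiv ^^ (p - p)) ([:-0, 1:] ^ p * S)) a) {0..1}"
      using p a poly_higher_pderiv_root_power[of _ p 0 S]
      by (intro deriv_chain_cut_power deriv_chain_higher_pderiv) auto
    then show "ip (cut_power p a) (poly L) = a ^ p * poly S a"
      using a unfolding S(2) by (intro ip_eqI) (auto simp: mult.commute)
  qed
qed

section \<open>The extremal problem\<close>

lemma poly_eqI_01:
  fixes p q :: "real poly"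
  assumes "\<And>x. x \<in> {0..1} \<Longrightarrow> poly p x = poly q x"
  shows "p = q"
proof (rule ccontr)
  assume "p \<noteq> q"
  then have "finite {x. poly (p - q) x = 0}" by (intro poly_roots_finite) simp
  moreover have "{0..1} \<subseteq> {x. poly (p - q) x = 0}" using assms by auto
  ultimately have "finite {0..1::real}" by (rule finite_subset[rotated])
  then show False using infinite_Icc[OF zero_less_one] by blast
qed

text \<open>As a polynomial in \<open>a\<close>, the squared distance is divisible by \<open>a ^ (2 * p - 1)\<close>; the symmetry
  \<open>a \<mapsto> 1 - a\<close> and the degree then determine it up to a constant.\<close>

theorem sq_dist_self:
  assumes a: "a \<in> {0..1}" and p: "0 < p"
  shows "sq_dist p p a = (a * (1 - a)) ^ (2 * p - 1) / ((2 * real p - 1) * (fact (p - 1))\<^sup>2)"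
proof -
  define N where "N = 2 * p - 1"
  have N: "2 * p = Suc N" using p by (simp add: N_def)
  define K :: real where "K = 1 / ((2 * real p - 1) * (fact (p - 1))\<^sup>2)"
  have K: "K \<noteq> 0" using p by (simp add: K_def)
  have "\<exists>S. degree S \<le> m \<and> (\<forall>a\<in>{0..1}. ip (cut_power p a) (poly (legendre m)) = a ^ p * poly S a)" for m
    using ip_cut_power_poly[OF p, of "legendre m"] unfolding degree_legendre by metis
  then obtain S where S: "\<And>m. degree (S m) \<le> m"
    "\<And>m a. a \<in> {0..1} \<Longrightarrow> ip (cut_power p a) (poly (legendre m)) = a ^ p * poly (S m) a"
    by metis
  define G where "G = (\<Sum>m<p. smult (2 * real m + 1) (S m ^ 2))"
  \<comment> \<open>The cofactor of \<open>a ^ N\<close> in the squared distance: the squared norm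
    gives \<open>K * a ^ N\<close>, and the squared moments carry \<open>a ^ (2 * p)\<close>, one
    power more.\<close>
  define e where "e = [:K:] - [:0, 1:] * G"
  have "degree G \<le> 2 * (p - 1)"
    unfolding G_def
  proof (rule degree_sum_le)
    fix m assume m: "m \<in> {..<p}"
    have "degree (S m ^ 2) \<le> degree (S m) * 2" by (rule degree_power_le)
    also have "\<dots> \<le> 2 * (p - 1)" using S(1)[of m] m by auto
    finally show "degree (smult (2 * real m + 1) (S m ^ 2)) \<le> 2 * (p - 1)"
      using degree_smult_le le_trans by blast
  qed simp
  then have "degree ([:0, 1:] * G) \<le> N"
    using degree_mult_le[of "[:0, 1:]" G] N p by simp
  then have deg: "degree e \<le> N"
    unfolding e_def by (intro degree_diff_le) simp_all
  have dist: "sq_dist p p x = x ^ N * poly e x" if x: "x \<in> {0..1}" for x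
  proof -
    have "(\<Sum>m<p. (2 * real m + 1) * (x ^ p * poly (S m) x)\<^sup>2) = x ^ (2 * p) * poly G x"
      unfolding G_def poly_sum sum_distrib_left
      by (intro sum.cong refl) (simp add: power_mult_distrib power_mult[symmetric] mult.commute[of p])
    then have "sq_dist p p x = x ^ N * K - x ^ (2 * p) * poly G x"
      using sq_dist_eq[OF x p, of p] ip_cut_power_cut_power[OF x p] S(2)[OF x]
      by (simp add: K_def N_def)
    then show ?thesis unfolding N by (simp add: e_def algebra_simps)
  qed
  have "[:0, 1:] ^ N * e = [:1, -1:] ^ N * (e \<circ>\<^sub>p [:1, -1:])"
  proof (rule poly_eqI_01)
    fix x :: real assume x: "x \<in> {0..1}"
    then have "1 - x \<in> {0..1}" by auto
    from dist[OF this] dist[OF x] sq_dist_reflect[OF x p]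
    show "poly ([:0, 1:] ^ N * e) x = poly ([:1, -1:] ^ N * (e \<circ>\<^sub>p [:1, -1:])) x"
      by (simp add: poly_pcompose)
  qed
  also have "\<dots> = [:-1, 1:] ^ N * (smult ((-1) ^ N) (e \<circ>\<^sub>p [:1, -1:]))"
  proof -
    have "[:1, -1:] = smult (-1) [:-1, 1::real:]" by simp
    then have "[:1, -1::real:] ^ N = smult ((-1) ^ N) ([:-1, 1:] ^ N)"
      by (metis smult_power)
    then show ?thesis by simp
  qed
  finally have "[:-1, 1:] ^ N dvd [:0, 1:] ^ N * e" by (metis dvd_triv_left)
  moreover have "poly e 0 = K" by (simp add: e_def)
  then have e0: "e \<noteq> 0" using K by auto
  \<comment> \<open>The factor \<open>[:0, 1:] ^ N\<close> does not vanish at 1, so all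
    \<open>N\<close> zeros there belong to \<open>e\<close>. The bound
    \<open>degree e \<le> N\<close> then leaves a constant, which \<open>poly e 0 = K\<close>
    determines.\<close>
  ultimately have "N \<le> order 1 ([:0, 1:] ^ N * e)"
    by (subst (asm) order_divides) simp
  also have "\<dots> = order 1 e"
    using e0 by (subst order_mult) (auto simp: order_0I)
  finally have "[:-1, 1:] ^ N dvd e" by (subst order_divides) simp
  then obtain r where r: "e = [:-1, 1:] ^ N * r" by (auto simp: dvd_def)
  with e0 have "degree e = N + degree r"
    by (subst r, subst degree_mult_eq) (auto simp: degree_power_eq)
  with deg have "degree r = 0" by simp
  then obtain c where c: "r = [:c:]" by (rule degree_eq_zeroE)
  have "odd N" using N by (metis dvd_triv_left even_Suc)
  have "poly e x = c * (x - 1) ^ N" for x by (simp add: r c mult.commute)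
  moreover from this[of 0] \<open>poly e 0 = K\<close> \<open>odd N\<close> have "c = - K" by simp
  ultimately have "poly e a = K * (1 - a) ^ N"
    using \<open>odd N\<close> power_minus_odd[of N "1 - a"] by simp
  then show ?thesis
    using dist[OF a] by (simp add: K_def N_def power_mult_distrib)
qed

section \<open>Sobolev functions as derivative chains\<close>

lemma deriv01_0 [simp]: "deriv01 0 f = f"
  by (simp add: deriv01_def)

lemma deriv01_Suc: "deriv01 (Suc j) f x = vector_derivative (deriv01 j f) (at x within {0..1})"
  by (simp add: deriv01_def)

lemma sobolev0_sq_integrable: "f \<in> sobolev0 n \<Longrightarrow> sq_integrable (deriv01 n f)"
  by (simp add: sobolev0_def sq_integrable_def)

lemma sobolev0_boundary: "\<lbrakk>f \<in> sobolev0 n; j < n\<rbrakk> \<Longrightarrow> deriv01 j f 0 = 0 \<and> deriv01 j f 1 = 0"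
  by (simp add: sobolev0_def)

lemma sobolev0_deriv_chain:
  assumes f: "f \<in> sobolev0 n"
  shows "deriv_chain n (\<lambda>j. deriv01 j f)"
  unfolding deriv_chain_def
proof (intro allI impI conjI)
  fix j assume j: "j < n"
  show "abs_cont_on 0 1 (deriv01 j f)" using f j by (simp add: sobolev0_def)
  have "\<exists>N. negligible N \<and> (\<forall>x\<in>{0..1} - N. deriv01 j f differentiable (at x within {0..1}))"
  proof (cases "j + 1 < n")
    case True
    then show ?thesis using f by (intro exI[of _ "{}"]) (simp add: sobolev0_def)
  next
    case False
    then have "j = n - 1" using j by simp
    then have "AE x in lebesgue_on {0..1}. deriv01 j f differentiable (at x within {0..1})"
      using f by (simp add: sobolev0_def)
    then obtain N where N: "{x \<in> space (lebesgue_on {0..1}).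
        \<not> deriv01 j f differentiable (at x within {0..1})} \<subseteq> N"
      "emeasure (lebesgue_on {0..1}) N = 0" "N \<in> sets (lebesgue_on {0..1})"
      by (rule AE_E)
    from N(2,3) have "N \<in> null_sets (lebesgue_on {0..1})" by (rule null_setsI)
    with N(1) show ?thesis
      by (intro exI[of _ N]) (auto simp: null_sets_restrict_space negligible_iff_null_sets)
  qed
  then show "\<exists>N. negligible N \<and> (\<forall>x\<in>{0..1} - N.
      (deriv01 j f has_vector_derivative deriv01 (Suc j) f x) (at x within {0..1}))"
    by (simp add: deriv01_Suc vector_derivative_works)
qed

lemma abs_cont_on_cong:
  assumes "\<And>x. x \<in> {a..b} \<Longrightarrow> F x = G x" "abs_cont_on a b F"
  shows "abs_cont_on a b G"
  unfolding abs_cont_on_def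
proof (intro allI impI)
  fix e :: real assume "e > 0"
  then obtain \<delta> where \<delta>: "\<delta> > 0"
    "\<forall>(m::nat) u v. (\<forall>i<m. a \<le> u i \<and> u i < v i \<and> v i \<le> b) \<and>
       disjoint_family_on (\<lambda>i. {u i<..<v i}) {..<m} \<and> (\<Sum>i<m. v i - u i) < \<delta>
      \<longrightarrow> (\<Sum>i<m. \<bar>F (v i) - F (u i)\<bar>) < e"
    using assms(2)[unfolded abs_cont_on_def] by blast
  show "\<exists>\<delta>>0. \<forall>(m::nat) u v. (\<forall>i<m. a \<le> u i \<and> u i < v i \<and> v i \<le> b) \<and>
       disjoint_family_on (\<lambda>i. {u i<..<v i}) {..<m} \<and> (\<Sum>i<m. v i - u i) < \<delta>
      \<longrightarrow> (\<Sum>i<m. \<bar>G (v i) - G (u i)\<bar>) < e"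
  proof (intro exI[of _ \<delta>] conjI \<delta>(1) allI impI)
    fix m :: nat and u v
    assume *: "(\<forall>i<m. a \<le> u i \<and> u i < v i \<and> v i \<le> b) \<and>
       disjoint_family_on (\<lambda>i. {u i<..<v i}) {..<m} \<and> (\<Sum>i<m. v i - u i) < \<delta>"
    have "(\<Sum>i<m. \<bar>G (v i) - G (u i)\<bar>) = (\<Sum>i<m. \<bar>F (v i) - F (u i)\<bar>)"
      using * by (intro sum.cong refl) (force simp: assms(1))
    moreover have "(\<Sum>i<m. \<bar>F (v i) - F (u i)\<bar>) < e" using \<delta>(2) * by blast
    ultimately show "(\<Sum>i<m. \<bar>G (v i) - G (u i)\<bar>) < e" by simp
  qed
qed

lemma AE_lebesgue_on_neq: "AE x in lebesgue_on {0..1}. x \<noteq> (a::real)"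
proof -
  have "AE x in lebesgue. x \<noteq> a" by (intro AE_completion AE_lborel_singleton)
  then show ?thesis by (subst AE_restrict_space_iff) auto
qed

lemma deriv01_eq_chain:
  assumes "\<And>j x. \<lbrakk>Suc j < n; x \<in> {0..1}\<rbrakk> \<Longrightarrow> (F j has_vector_derivative F (Suc j) x) (at x within {0..1})"
  shows "\<lbrakk>j < n; x \<in> {0..1}\<rbrakk> \<Longrightarrow> deriv01 j (F 0) x = F j x"
proof (induction j arbitrary: x)
  case (Suc j)
  then have "(F j has_vector_derivative F (Suc j) x) (at x within {0..1})" by (intro assms)
  then have "(deriv01 j (F 0) has_vector_derivative F (Suc j) x) (at x within {0..1})"
    using Suc by (intro has_vector_derivative_transform[of x "{0..1}" "deriv01 j (F 0)" "F j"]) auto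
  then show ?case
    unfolding deriv01_Suc using Suc.prems by (intro vector_derivative_within_closed_interval) auto
qed simp

lemma sobolev0_chainI:
  assumes n: "0 < n"
    and der: "\<And>j x. \<lbrakk>Suc j < n; x \<in> {0..1}\<rbrakk> \<Longrightarrow> (F j has_vector_derivative F (Suc j) x) (at x within {0..1})"
    and AC: "\<And>j. j < n \<Longrightarrow> abs_cont_on 0 1 (F j)"
    and last: "\<And>x. x \<in> {0..1} - {a} \<Longrightarrow> (F (n - 1) has_vector_derivative F n x) (at x within {0..1})"
    and sq: "sq_integrable (F n)"
    and bd: "\<And>j. j < n \<Longrightarrow> F j 0 = 0" "\<And>j. j < n \<Longrightarrow> F j 1 = 0"
  shows "F 0 \<in> sobolev0 n" "\<And>x. x \<in> {0..1} - {a} \<Longrightarrow> deriv01 n (F 0) x = F n x"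
proof -
  have eq: "deriv01 j (F 0) x = F j x" if "j < n" "x \<in> {0..1}" for j x
    by (rule deriv01_eq_chain[of n F, OF der that])
  have der': "(deriv01 j (F 0) has_vector_derivative F (Suc j) x) (at x within {0..1})"
    if "(F j has_vector_derivative F (Suc j) x) (at x within {0..1})" "j < n" "x \<in> {0..1}" for j x
    using that eq by (intro has_vector_derivative_transform[of x "{0..1}" "deriv01 j (F 0)" "F j"]) auto
  have last': "(deriv01 (n - 1) (F 0) has_vector_derivative F n x) (at x within {0..1})"
    if "x \<in> {0..1} - {a}" for x
    using der'[of "n - 1" x] last[OF that] that n by simp
  show top: "deriv01 n (F 0) x = F n x" if "x \<in> {0..1} - {a}" for x
    using last'[OF that] that n deriv01_Suc[of "n - 1" "F 0" x]
      vector_derivative_within_closed_interval[of 0 1 x "deriv01 (n - 1) (F 0)"] by simp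
  have AEtop: "AE x in lebesgue_on {0..1}. deriv01 n (F 0) x = F n x"
    using AE_lebesgue_on_neq[of a] AE_space by eventually_elim (simp add: top)
  \<comment> \<open>At \<open>a\<close> the value of \<open>deriv01 n (F 0)\<close> is unknown, but
    a single point does not affect measurability.\<close>
  have meas: "deriv01 n (F 0) \<in> borel_measurable (lebesgue_on {0..1})"
  proof (subst measurable_cong)
    show "deriv01 n (F 0) x = (if x = a then deriv01 n (F 0) a else F n x)"
      if "x \<in> space (lebesgue_on {0..1})" for x using top[of x] that by simp
    have "{x \<in> space (lebesgue_on {0..1}). x = a} \<in> sets (lebesgue_on {0..1})"
    proof -
      have "{x \<in> space (lebesgue_on {0..1}). x = a} = {a} \<inter> {0..1}" by auto
      then show ?thesis by (simp add: sets_restrict_space_iff)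
    qed
    then show "(\<lambda>x. if x = a then deriv01 n (F 0) a else F n x) \<in> borel_measurable (lebesgue_on {0..1})"
      using sq by (intro measurable_If) (auto simp: sq_integrable_def)
  qed
  show "F 0 \<in> sobolev0 n"
    unfolding sobolev0_def mem_Collect_eq
  proof (intro conjI allI impI ballI)
    show "deriv01 j (F 0) differentiable (at x within {0..1})" if "j + 1 < n" "x \<in> {0..1}" for j x
      using der'[OF der[of j x]] that by (auto simp: differentiableI_vector)
    show "abs_cont_on 0 1 (deriv01 j (F 0))" if "j < n" for j
      by (rule abs_cont_on_cong[OF _ AC[OF that]]) (simp add: eq that)
    show "AE x in lebesgue_on {0..1}. deriv01 (n - 1) (F 0) differentiable (at x within {0..1})"
      using AE_lebesgue_on_neq[of a] AE_space
      by eventually_elim (use last' in \<open>auto intro: differentiableI_vector\<close>)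
    show "deriv01 n (F 0) \<in> borel_measurable (lebesgue_on {0..1})" by (rule meas)
    have "integrable (lebesgue_on {0..1}) (\<lambda>x. \<bar>deriv01 n (F 0) x\<bar>\<^sup>2)
      = integrable (lebesgue_on {0..1}) (\<lambda>x. (F n x)\<^sup>2)"
      using meas sq AEtop by (intro integrable_cong_AE) (auto simp: sq_integrable_def)
    then show "integrable (lebesgue_on {0..1}) (\<lambda>x. \<bar>deriv01 n (F 0) x\<bar>\<^sup>2)"
      using sq by (simp add: sq_integrable_def)
    show "deriv01 j (F 0) 0 = 0" "deriv01 j (F 0) 1 = 0" if "j < n" for j
      using eq[OF that] bd[OF that] by auto
  qed
qed

section \<open>Sobolev functions with prescribed top derivative\<close>

primrec iter_integral :: "(real \<Rightarrow> real) \<Rightarrow> nat \<Rightarrow> real \<Rightarrow> real" where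
  "iter_integral u 0 = u"
| "iter_integral u (Suc j) = (\<lambda>x. integral {0..x} (iter_integral u j))"

text \<open>Since \<open>u\<close> may jump, the first integral is only known to be Lipschitz, by
  the bound on \<open>u\<close>; all later ones are continuously differentiable.\<close>

lemma iter_integral_1_abs_cont:
  assumes u: "sq_integrable u" and C: "\<And>x. x \<in> {0..1} \<Longrightarrow> \<bar>u x\<bar> \<le> C"
  shows "u integrable_on {0..1}" "abs_cont_on 0 1 (iter_integral u 1)"
proof -
  show int: "u integrable_on {0..1}"
    using has_integral_ip[OF u sq_integrable_poly[of 1]] by (auto simp: integrable_on_def)
  have C0: "0 \<le> C" using C[of 0] by force
  have le: "\<bar>iter_integral u 1 y - iter_integral u 1 x\<bar> \<le> C * \<bar>y - x\<bar>"
    if "x \<in> {0..1}" "y \<in> {0..1}" "x \<le> y" for x y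
  proof -
    have iy: "u integrable_on {0..y}" "u integrable_on {x..y}"
      using that by (auto intro: integrable_on_subinterval[OF int])
    have "integral {0..x} u + integral {x..y} u = integral {0..y} u"
      using that iy by (intro Henstock_Kurzweil_Integration.integral_combine) auto
    moreover have "norm (integral {x..y} u) \<le> C * measure lborel {x..y}"
      using that C C0 iy(2) by (intro has_integral_bound_real[of C "{}" u]) (auto simp: integrable_integral)
    ultimately show ?thesis using that by simp
  qed
  show "abs_cont_on 0 1 (iter_integral u 1)"
  proof (rule abs_cont_on_lipschitz)
    fix x y :: real assume "x \<in> {0..1}" "y \<in> {0..1}"
    then show "\<bar>iter_integral u 1 y - iter_integral u 1 x\<bar> \<le> C * \<bar>y - x\<bar>"
      using le[of x y] le[of y x] by (cases "x \<le> y") (auto simp: abs_minus_commute)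
  qed
qed

lemma iter_integral_Suc:
  assumes "sq_integrable u" "\<And>x. x \<in> {0..1} \<Longrightarrow> \<bar>u x\<bar> \<le> C"
  shows "abs_cont_on 0 1 (iter_integral u (Suc j))"
    "x \<in> {0..1} \<Longrightarrow>
      (iter_integral u (Suc (Suc j)) has_vector_derivative iter_integral u (Suc j) x) (at x within {0..1})"
proof -
  have der: "(iter_integral u (Suc (Suc j)) has_vector_derivative iter_integral u (Suc j) x) (at x within {0..1})"
    if "abs_cont_on 0 1 (iter_integral u (Suc j))" "x \<in> {0..1}" for j x
    using integral_has_vector_derivative[OF abs_cont_on_continuous[OF that(1)] that(2)]
    by simp
  have AC: "abs_cont_on 0 1 (iter_integral u (Suc j))" for j
  proof (induction j)
    case 0
    show ?case using iter_integral_1_abs_cont(2)[OF assms] by simp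
  next
    case (Suc j)
    obtain B where "\<And>x. x \<in> {0..1} \<Longrightarrow> \<bar>iter_integral u (Suc j) x\<bar> \<le> B"
      using continuous_on_Icc_bounded[OF abs_cont_on_continuous[OF Suc]] by blast
    with der[OF Suc] show ?case by (rule abs_cont_on_deriv_bounded)
  qed
  show "abs_cont_on 0 1 (iter_integral u (Suc j))" by (rule AC)
  show "(iter_integral u (Suc (Suc j)) has_vector_derivative iter_integral u (Suc j) x) (at x within {0..1})"
    if "x \<in> {0..1}" by (rule der[OF AC that])
qed

text \<open>Orthogonality of \<open>u\<close> to the powers of \<open>x - 1\<close> gives the boundary conditions at 1.\<close>

theorem sobolev0_with_top_derivative:
  assumes n: "0 < n" and u: "sq_integrable u" and C: "\<And>x. x \<in> {0..1} \<Longrightarrow> \<bar>u x\<bar> \<le> C"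
    and cont: "\<And>x. x \<in> {0..1} - {a} \<Longrightarrow> continuous (at x within {0..1}) u"
    and orth: "\<And>h. degree h < n \<Longrightarrow> ip u (poly h) = 0"
  obtains f where "f \<in> sobolev0 n" "\<And>x. x \<in> {0..1} - {a} \<Longrightarrow> deriv01 n f x = u x"
    "\<And>p b. \<lbrakk>0 < p; p \<le> n; b \<in> {0..1}\<rbrakk> \<Longrightarrow> deriv01 (n - p) f b = ip u (cut_power p b)"
proof -
  define F where "F j = iter_integral u (n - j)" for j
  have Fn: "F n = u" by (simp add: F_def)
  have F_Suc: "F j = iter_integral u (Suc (n - Suc j))" if "j < n" for j
    using that by (simp add: F_def Suc_diff_Suc del: iter_integral.simps)
  have der: "(F j has_vector_derivative F (Suc j) x) (at x within {0..1})"
    if "Suc j < n" "x \<in> {0..1}" for j x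
    using iter_integral_Suc(2)[OF u C that(2), of "n - Suc (Suc j)"] F_Suc[of j] F_Suc[of "Suc j"] that
    by (simp add: Suc_diff_Suc del: iter_integral.simps)
  have AC: "abs_cont_on 0 1 (F j)" if "j < n" for j
    unfolding F_Suc[OF that] by (rule iter_integral_Suc(1)[OF u C])
  have last: "(F (n - 1) has_vector_derivative F n x) (at x within {0..1})" if "x \<in> {0..1} - {a}" for x
    using integral_has_vector_derivative_continuous_at[of u 0 1 x "{}"]
      iter_integral_1_abs_cont(1)[OF u C] cont[OF that] that n by (simp add: F_def)
  have F0: "F j 0 = 0" if "j < n" for j
    unfolding F_Suc[OF that] by simp
  have chain: "deriv_chain n F"
    unfolding deriv_chain_def
  proof (intro allI impI conjI AC)
    fix j assume j: "j < n"
    show "\<exists>N. negligible N \<and> (\<forall>x\<in>{0..1} - N. (F j has_vector_derivative F (Suc j) x) (at x within {0..1}))"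
    proof (cases "Suc j < n")
      case True
      then show ?thesis using der by (intro exI[of _ "{}"]) auto
    next
      case False
      then have "n = Suc j" using j by simp
      then show ?thesis using last by (intro exI[of _ "{a}"]) auto
    qed
  qed
  have F1: "F j 1 = 0" if j: "j < n" for j
  proof -
    \<comment> \<open>Pairing \<open>u\<close> with \<open>(x - 1) ^ i\<close> leaves at 1 only the
      boundary term \<open>l = i\<close>, and this \<open>i\<close> makes it contain
      \<open>F j 1\<close>.\<close>
    define i where "i = n - 1 - j"
    have i: "i < n" "n - 1 - i = j" using j by (auto simp: i_def)
    define h :: "real poly" where "h = [:-1, 1:] ^ i * 1"
    have deg: "degree h = i" by (simp add: h_def degree_power_eq)
    have Dh: "poly ((pderiv ^^ l) h) 1 = (if l = i then fact i else 0)" for l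
    proof (cases "l \<le> i")
      case True
      then show ?thesis unfolding h_def using poly_higher_pderiv_root_power[OF True, of 1 1] by auto
    next
      case False
      then show ?thesis using degree_higher_pderiv_eq_0[of h l] deg by auto
    qed
    have "((\<lambda>x. F n x * poly h x) has_integral
      (\<Sum>l<n. (-1) ^ l * (F (n - 1 - l) 1 * poly ((pderiv ^^ l) h) 1
                          - F (n - 1 - l) 0 * poly ((pderiv ^^ l) h) 0))) {0..1}"
      using i deg by (intro deriv_chain_integration_by_parts chain degree_higher_pderiv_eq_0) auto
    also have "(\<Sum>l<n. (-1) ^ l * (F (n - 1 - l) 1 * poly ((pderiv ^^ l) h) 1
                          - F (n - 1 - l) 0 * poly ((pderiv ^^ l) h) 0))
        = (\<Sum>l<n. if l = i then (-1) ^ i * (F j 1 * fact i) else 0)"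
      by (intro sum.cong refl) (use i(2) F0 in \<open>auto simp: Dh\<close>)
    also have "\<dots> = (-1) ^ i * (F j 1 * fact i)" using i by simp
    finally have "ip u (poly h) = (-1) ^ i * (F j 1 * fact i)"
      using u unfolding Fn by (intro ip_eqI) auto
    then show ?thesis using orth[of h] deg i by simp
  qed
  have sq: "sq_integrable (F n)" using u Fn by simp
  show thesis
  proof (rule that[of "F 0"])
    show "F 0 \<in> sobolev0 n" by (rule sobolev0_chainI(1)[OF n der AC last sq F0 F1])
    show "deriv01 n (F 0) x = u x" if "x \<in> {0..1} - {a}" for x
      unfolding Fn[symmetric] by (rule sobolev0_chainI(2)[OF n der AC last sq F0 F1 that])
    fix p :: nat and b :: real assume pb: "0 < p" "p \<le> n" "b \<in> {0..1}"
    have "deriv01 (n - p) (F 0) b = F (n - p) b"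
      using pb n by (intro deriv01_eq_chain[of n F, OF der]) auto
    also have "\<dots> = ip u (cut_power p b)"
      using deriv_chain_cut_power[OF chain F0 pb] u pb(3) unfolding Fn
      by (intro ip_eqI[symmetric]) auto
    finally show "deriv01 (n - p) (F 0) b = ip u (cut_power p b)" .
  qed
qed

text \<open>The top derivative is orthogonal to \<open>proj_poly n p a\<close>, so the truncated
  power may be replaced by its residual before Cauchy-Schwarz is applied; this makes the bound
  sharp.\<close>

lemma sobolev0_deriv_bound:
  assumes f: "f \<in> sobolev0 n" and p: "0 < p" "p \<le> n" and a: "a \<in> {0..1}"
  shows "(deriv01 (n - p) f a)\<^sup>2 \<le> ip (deriv01 n f) (deriv01 n f) * sq_dist n p a"
proof -
  let ?u = "deriv01 n f"
  have u: "sq_integrable ?u" by (rule sobolev0_sq_integrable[OF f])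
  have chain: "deriv_chain n (\<lambda>j. deriv01 j f)" by (rule sobolev0_deriv_chain[OF f])
  have "ip ?u (cut_power p a) = deriv01 (n - p) f a"
    using deriv_chain_cut_power[OF chain _ p a] sobolev0_boundary[OF f] u a
    by (intro ip_eqI) auto
  moreover have "ip ?u (poly (proj_poly n p a)) = 0"
    using deriv_chain_orthogonal_poly[OF chain, of "proj_poly n p a"] sobolev0_boundary[OF f] p u
      degree_proj_poly[of n p a] by (intro ip_eqI) auto
  ultimately have "ip ?u (resid n p a) = deriv01 (n - p) f a"
    using ip_resid[OF a u, of n p] by (simp add: ip_commute[of ?u])
  then show ?thesis
    using ip_Cauchy_Schwarz[OF u sq_integrable_resid[OF a], of n p] by (simp add: sq_dist_def)
qed

lemma continuous_resid:
  assumes "x \<noteq> a" shows "continuous (at x within S) (resid n p a)"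
proof -
  have "isCont (cut_power p a) x"
  proof (cases "x < a")
    case True
    have "continuous_on {..<a} (cut_power p a)"
      by (subst continuous_on_cong[OF refl, of _ _ "\<lambda>x. (a - x) ^ (p - 1) / fact (p - 1)"])
        (auto simp: cut_power_def intro!: continuous_intros)
    then show ?thesis using True by (simp add: continuous_on_eq_continuous_at)
  next
    case False
    have "continuous_on {a<..} (cut_power p a)"
      by (subst continuous_on_cong[OF refl, of _ _ "\<lambda>x. 0"])
        (auto simp: cut_power_def intro!: continuous_intros)
    then show ?thesis using False assms by (simp add: continuous_on_eq_continuous_at)
  qed
  then have "isCont (resid n p a) x" unfolding resid_def by (intro continuous_intros)
  then show ?thesis by (rule continuous_at_imp_continuous_at_within)
qed

lemma resid_bounded:
  assumes a: "a \<in> {0..1}"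
  obtains C where "\<And>x. x \<in> {0..1} \<Longrightarrow> \<bar>resid n p a x\<bar> \<le> C"
proof -
  obtain B where B: "\<And>x. x \<in> {0..1} \<Longrightarrow> \<bar>poly (proj_poly n p a) x\<bar> \<le> B"
    by (rule continuous_on_Icc_bounded[of 0 1 "poly (proj_poly n p a)"]) (auto intro: continuous_intros)
  show thesis
  proof (rule that[of "1 + B"])
    fix x :: real assume x: "x \<in> {0..1}"
    show "\<bar>resid n p a x\<bar> \<le> 1 + B"
      using B[OF x] cut_power_bounded[OF x a, of p] by (simp add: resid_def)
  qed
qed

text \<open>Equality in Cauchy-Schwarz calls for an \<open>f\<close> whose top derivative is a
  multiple of the residual. The residual is bounded, continuous away from \<open>a\<close> and
  orthogonal to degrees below \<open>n\<close>, so such an \<open>f\<close> exists and the supremum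
  is a maximum.\<close>

theorem A_const_eq_sqrt_sq_dist:
  assumes p: "0 < p" "p \<le> n" and a: "a \<in> {0..1}"
  shows "A_const n (n - p) a = sqrt (sq_dist n p a)"
  unfolding A_const_def
proof (rule cSup_eq_maximum)
  define E where "E = sq_dist n p a"
  have E0: "E \<ge> 0" by (simp add: E_def sq_dist_def ip_nonneg)
  \<comment> \<open>Normalises the residual. For \<open>E = 0\<close>, as at the endpoints, division
    by zero gives \<open>s = 0\<close>, and a function with zero top derivative attains the supremum
    0.\<close>
  define s where "s = 1 / sqrt E"
  let ?u = "\<lambda>x. s * resid n p a x"
  have n: "0 < n" using p by simp
  have sw: "sq_integrable (resid n p a)" by (rule sq_integrable_resid[OF a])
  obtain C where C: "\<And>x. x \<in> {0..1} \<Longrightarrow> \<bar>resid n p a x\<bar> \<le> C"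
    using resid_bounded[OF a] by blast
  have C': "\<bar>?u x\<bar> \<le> \<bar>s\<bar> * C" if "x \<in> {0..1}" for x
    using C[OF that] by (simp add: abs_mult mult_left_mono)
  have orth: "ip ?u (poly h) = 0" if "degree h < n" for h
    using resid_orthogonal_poly[OF a that, of p] by (simp add: ip_scale)
  have cont: "continuous (at x within {0..1}) ?u" if "x \<in> {0..1} - {a}" for x
    using that by (intro continuous_mult continuous_const continuous_resid) auto
  obtain f where f: "f \<in> sobolev0 n" "\<And>x. x \<in> {0..1} - {a} \<Longrightarrow> deriv01 n f x = ?u x"
    "\<And>q b. \<lbrakk>0 < q; q \<le> n; b \<in> {0..1}\<rbrakk> \<Longrightarrow> deriv01 (n - q) f b = ip ?u (cut_power q b)"
    using sobolev0_with_top_derivative[OF n sq_integrable_scale[OF sw, of s] C' cont orth] by blast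
  have "AE x in lebesgue_on {0..1}. \<bar>deriv01 n f x\<bar>\<^sup>2 = ?u x * ?u x"
    using AE_lebesgue_on_neq[of a] AE_space
    by eventually_elim (use f(2) in \<open>simp add: power2_eq_square\<close>)
  then have "(LINT x|lebesgue_on {0..1}. \<bar>deriv01 n f x\<bar>\<^sup>2) = ip ?u ?u"
    unfolding ip_def using sobolev0_sq_integrable[OF f(1)] sw
    by (intro integral_cong_AE) (auto simp: sq_integrable_def)
  also have "\<dots> = s\<^sup>2 * E"
    using ip_scale[of s "resid n p a" ?u] ip_scale[of s "resid n p a" "resid n p a"]
    by (simp add: E_def sq_dist_def ip_commute[of "resid n p a" ?u] power2_eq_square)
  also have "\<dots> \<le> 1" using E0 by (simp add: s_def power_divide)
  finally have 1: "(LINT x|lebesgue_on {0..1}. \<bar>deriv01 n f x\<bar>\<^sup>2) \<le> 1" .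
  have "deriv01 (n - p) f a = s * E"
    using f(3)[OF p a] sq_dist_eq_ip_cut_power[OF a n, of p] by (simp add: ip_scale E_def)
  also have "\<dots> = sqrt E" using E0 by (simp add: s_def real_div_sqrt)
  finally have "sqrt E = \<bar>deriv01 (n - p) f a\<bar>" using E0 by simp
  with f(1) 1 show "sqrt (sq_dist n p a) \<in> {\<bar>deriv01 (n - p) f a\<bar> |f.
      f \<in> sobolev0 n \<and> (LINT x|lebesgue_on {0..1}. \<bar>deriv01 n f x\<bar>\<^sup>2) \<le> 1}"
    unfolding E_def by blast
next
  fix y assume "y \<in> {\<bar>deriv01 (n - p) f a\<bar> |f.
      f \<in> sobolev0 n \<and> (LINT x|lebesgue_on {0..1}. \<bar>deriv01 n f x\<bar>\<^sup>2) \<le> 1}"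
  then obtain f where y: "y = \<bar>deriv01 (n - p) f a\<bar>" and f: "f \<in> sobolev0 n"
    and le: "(LINT x|lebesgue_on {0..1}. \<bar>deriv01 n f x\<bar>\<^sup>2) \<le> 1" by blast
  have "ip (deriv01 n f) (deriv01 n f) \<le> 1"
    using le by (simp add: ip_def power2_eq_square)
  then have "ip (deriv01 n f) (deriv01 n f) * sq_dist n p a \<le> sq_dist n p a"
    using mult_right_mono[of _ 1 "sq_dist n p a"] by (simp add: sq_dist_def ip_nonneg)
  then have "(deriv01 (n - p) f a)\<^sup>2 \<le> sq_dist n p a"
    using sobolev0_deriv_bound[OF f p a] by linarith
  then show "y \<le> sqrt (sq_dist n p a)"
    unfolding y using real_sqrt_le_mono[of "(deriv01 (n - p) f a)\<^sup>2"] by simp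
qed

section \<open>The case of the fifth derivative\<close>

text \<open>The cofactor of \<open>parabola ^ m\<close> in the \<open>j\<close>-th derivative of
  \<open>parabola ^ (m + j)\<close>. One more derivative costs one power of \<open>parabola\<close>,
  hence the argument \<open>Suc m\<close> in the recursion.\<close>

primrec rodrigues_factor :: "nat \<Rightarrow> nat \<Rightarrow> real poly" where
  "rodrigues_factor 0 m = 1"
| "rodrigues_factor (Suc j) m = smult (1 + real m) ([:-1, 2:] * rodrigues_factor j (Suc m))
     + parabola * pderiv (rodrigues_factor j (Suc m))"

lemma higher_pderiv_parabola_power:
  "(pderiv ^^ j) (parabola ^ (m + j)) = parabola ^ m * rodrigues_factor j m"
proof (induction j arbitrary: m)
  case (Suc j)
  have "(pderiv ^^ Suc j) (parabola ^ (m + Suc j)) = pderiv (parabola ^ Suc m * rodrigues_factor j (Suc m))"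
    using Suc[of "Suc m"] by simp
  also have "\<dots> = parabola ^ m * rodrigues_factor (Suc j) m"
    unfolding pderiv_mult pderiv_power_Suc by (simp add: pderiv_pCons algebra_simps)
  finally show ?case .
qed simp

lemma rodrigues_factor_1: "rodrigues_factor 1 m = [:- (1 + real m), 2 * (1 + real m):]"
  by simp

lemma rodrigues_factor_2:
  "rodrigues_factor 2 m = smult (real m + 2) [:real m + 1, - 4 * real m - 6, 4 * real m + 6:]"
proof -
  have "rodrigues_factor 2 m = smult (1 + real m) ([:-1, 2:] * rodrigues_factor 1 (Suc m))
     + parabola * pderiv (rodrigues_factor 1 (Suc m))"
    by (simp add: numeral_2_eq_2)
  then show ?thesis
    unfolding rodrigues_factor_1 by (simp add: pderiv_pCons algebra_simps)
qed

lemma rodrigues_factor_3: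
  "rodrigues_factor 3 m = smult ((real m + 3) * (real m + 2))
     ([:-1, 2:] * [:real m + 1, - 4 * real m - 10, 4 * real m + 10:])"
proof -
  have "rodrigues_factor 3 m = smult (1 + real m) ([:-1, 2:] * rodrigues_factor 2 (Suc m))
     + parabola * pderiv (rodrigues_factor 2 (Suc m))"
    by (simp add: numeral_3_eq_3 numeral_2_eq_2)
  then show ?thesis
    unfolding rodrigues_factor_2 by (simp add: pderiv_pCons algebra_simps)
qed

lemma rodrigues_factor_4:
  "rodrigues_factor 4 m = smult ((real m + 4) * (real m + 3))
     (smult ((real m + 1) * (real m + 2)) ([:1, -4, 4:] * [:1, -4, 4:])
      + smult (12 * (real m + 2)) (parabola * [:1, -4, 4:]) + smult 12 (parabola * parabola))"
proof -
  have "rodrigues_factor 4 m = smult (1 + real m) ([:-1, 2:] * rodrigues_factor 3 (Suc m))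
     + parabola * pderiv (rodrigues_factor 3 (Suc m))"
    by (simp add: eval_nat_numeral)
  then show ?thesis
    unfolding rodrigues_factor_3 by (simp add: pderiv_pCons algebra_simps)
qed

text \<open>The right-hand side of \<open>poly_quintic\<close> expanded in \<open>t\<close>, with
  \<open>x = n - 5\<close>. Explicit coefficients allow \<open>pderiv\<close> to be computed and
  make \<open>quintic_pderiv\<close> an identity in \<open>x\<close> and \<open>t\<close>.\<close>

definition quintic :: "real \<Rightarrow> real poly" where
  "quintic x = [:x ^ 6 + 6 * x ^ 5 + 13 * x ^ 4 + 12 * x ^ 3 + 4 * x ^ 2,
     20 * x ^ 6 + 160 * x ^ 5 + 475 * x ^ 4 + 610 * x ^ 3 + 235 * x ^ 2 - 140 * x - 100,
     160 * x ^ 6 + 1600 * x ^ 5 + 6040 * x ^ 4 + 10240 * x ^ 3 + 6280 * x ^ 2 - 1760 * x - 2400,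
     640 * x ^ 6 + 7680 * x ^ 5 + 35200 * x ^ 4 + 74400 * x ^ 3 + 63160 * x ^ 2 - 4680 * x - 25200,
     1280 * x ^ 6 + 17920 * x ^ 5 + 96640 * x ^ 4 + 244480 * x ^ 3 + 262480 * x ^ 2 + 18400 * x - 112000,
     1024 * x ^ 6 + 16384 * x ^ 5 + 101632 * x ^ 4 + 299008 * x ^ 3 + 385216 * x ^ 2 + 71680 * x - 176400:]"

text \<open>The first summand is the squared distance for \<open>n = p\<close>; the other five come
  from the moments of degree \<open>m = p, ..., p + 4\<close>, weighted by \<open>2 * m + 1\<close>.
  The moments with odd \<open>m - p\<close> carry the factor \<open>2 * a - 1\<close>, whose square
  is \<open>1 + 4 * t\<close>. The common factor \<open>t\<close> is what remains of
  \<open>(t ^ p)\<^sup>2\<close> once \<open>(-t) ^ (2 * p - 1)\<close> is split off.\<close>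

lemma poly_quintic:
  "poly (quintic x) t = (x * (x + 1) * (x + 2))\<^sup>2 + (2 * x - 1) * t *
     ((2 * x + 1) * ((x + 1) * (x + 2))\<^sup>2 + (2 * x + 3) * ((x + 1) * (x + 2))\<^sup>2 * (1 + 4 * t)
      + (2 * x + 5) * ((x + 2) * ((x + 1) * (1 + 4 * t) + 2 * t))\<^sup>2
      + (2 * x + 7) * ((x + 2) * ((x + 1) * (1 + 4 * t) + 6 * t))\<^sup>2 * (1 + 4 * t)
      + (2 * x + 9) * ((x + 2) * (x + 1) * (1 + 4 * t)\<^sup>2 + 12 * (x + 2) * t * (1 + 4 * t) + 12 * t\<^sup>2)\<^sup>2)"
  unfolding quintic_def by simp algebra

definition sq_dist_poly5 :: "nat \<Rightarrow> real poly" where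
  "sq_dist_poly5 p = [:0, -1:] ^ (2 * p - 1) * quintic (real p)"

theorem sq_dist_5:
  assumes a: "a \<in> {0..1}" and p: "0 < p"
  shows "sq_dist (p + 5) p a * (fact (p + 2))\<^sup>2 * (2 * real p - 1) = poly (sq_dist_poly5 p) (a\<^sup>2 - a)"
proof -
  define x where "x = real p"
  define t where "t = a\<^sup>2 - a"
  define B where "B = 2 * a - 1"
  define Z where "Z = (-t) ^ (2 * p - 1)"
  define R where "R j = ip (cut_power p a) (poly (legendre (p + j)))" for j
  \<comment> \<open>This factorial clears all denominators: the extra factors \<open>x + 3\<close>
    and \<open>x + 4\<close> of \<open>fact (p + 3)\<close> and \<open>fact (p + 4)\<close> cancel
    against the Rodrigues factors.\<close>
  define K where "K = (fact (p + 2) :: real)"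
  have B2: "B\<^sup>2 = 1 + 4 * t" by (simp add: B_def t_def power2_eq_square algebra_simps)
  have x: "x \<ge> 1" using p by (simp add: x_def)
  have tp: "(t ^ p)\<^sup>2 = - t * Z"
  proof -
    have "(t ^ p)\<^sup>2 = (-t) ^ (2 * p)" by (simp add: power_mult[symmetric] mult.commute)
    also have "2 * p = Suc (2 * p - 1)" using p by simp
    finally show ?thesis by (simp add: Z_def)
  qed
  have R: "R j = t ^ p * poly (rodrigues_factor j p) a / fact (p + j)" for j
  proof -
    have "poly parabola a = t" by (simp add: t_def power2_eq_square algebra_simps)
    then show ?thesis
      using ip_cut_power_legendre_ge[OF a p, of "p + j"]
      by (simp add: R_def higher_pderiv_parabola_power del: poly_pCons)
  qed
  have nz: "x + 1 \<noteq> 0" "x + 2 \<noteq> 0" "x + 3 \<noteq> 0" "x + 4 \<noteq> 0" using x by auto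
  have Kp: "K = (x + 2) * ((x + 1) * fact p)" "K = (x + 2) * fact (p + 1)"
    by (simp_all add: K_def x_def eval_nat_numeral algebra_simps)
  then have f01: "fact p = K / ((x + 2) * (x + 1))" "fact (p + 1) = K / (x + 2)"
    using nz by (simp_all add: add.commute)
  have f234: "fact (p + 2) = K" "fact (p + 3) = (x + 3) * K" "fact (p + 4) = (x + 4) * (x + 3) * K"
    by (simp_all add: K_def x_def eval_nat_numeral algebra_simps)
  note f = f01 f234
  have K: "K \<noteq> 0" by (simp add: K_def)
  have R0: "K * R 0 = t ^ p * ((x + 1) * (x + 2))"
    using R[of 0] nz K by (simp add: f)
  have R1: "K * R 1 = t ^ p * ((x + 1) * (x + 2)) * B"
  proof -
    have "poly (rodrigues_factor 1 p) a = (x + 1) * B"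
      unfolding rodrigues_factor_1 by (simp add: x_def B_def algebra_simps)
    then show ?thesis using R[of 1] nz K unfolding f by (simp add: mult_ac)
  qed
  have R2: "K * R 2 = t ^ p * ((x + 2) * ((x + 1) * (1 + 4 * t) + 2 * t))"
  proof -
    have "poly (rodrigues_factor 2 p) a = (x + 2) * ((x + 1) * (1 + 4 * t) + 2 * t)"
      unfolding rodrigues_factor_2 by (simp add: x_def t_def power2_eq_square algebra_simps)
    then show ?thesis using R[of 2] nz K unfolding f by (simp add: mult_ac)
  qed
  have R3: "K * R 3 = t ^ p * ((x + 2) * ((x + 1) * (1 + 4 * t) + 6 * t)) * B"
  proof -
    have "poly (rodrigues_factor 3 p) a = (x + 3) * ((x + 2) * ((x + 1) * (1 + 4 * t) + 6 * t) * B)"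
      unfolding rodrigues_factor_3 by (simp add: x_def t_def B_def power2_eq_square algebra_simps)
    then show ?thesis using R[of 3] nz K unfolding f by (simp add: mult_ac)
  qed
  have R4: "K * R 4 = t ^ p * ((x + 2) * (x + 1) * (1 + 4 * t)\<^sup>2 + 12 * (x + 2) * t * (1 + 4 * t) + 12 * t\<^sup>2)"
    (is "_ = _ * ?r")
  proof -
    have "poly [:1, -4, 4:] a = 1 + 4 * t" "poly parabola a = t"
      by (simp_all add: t_def power2_eq_square algebra_simps)
    then have "poly (rodrigues_factor 4 p) a = (x + 4) * (x + 3) * ?r"
      unfolding rodrigues_factor_4 poly_smult poly_add poly_mult
      by (simp add: x_def power2_eq_square mult_ac)
    then show ?thesis using R[of 4] nz K unfolding f by (simp add: mult_ac)
  qed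
  have base: "sq_dist p p a * K\<^sup>2 * (2 * x - 1) = (x * (x + 1) * (x + 2))\<^sup>2 * Z"
  proof -
    have "fact p = x * fact (p - 1)" using p by (simp add: x_def fact_reduce)
    then have "K = x * (x + 1) * (x + 2) * fact (p - 1)"
      by (subst Kp(1)) (simp add: mult_ac)
    moreover have "2 * x - 1 \<noteq> 0" using x by auto
    moreover have "a * (1 - a) = - t" by (simp add: t_def power2_eq_square algebra_simps)
    ultimately show ?thesis
      using sq_dist_self[OF a p] by (simp add: Z_def x_def power_mult_distrib)
  qed
  have "sq_dist (p + 5) p a = sq_dist p p a - (\<Sum>m\<in>{p..<p + 5}. (2 * real m + 1) * (ip (cut_power p a) (poly (legendre m)))\<^sup>2)"
    using sq_dist_eq[OF a, of "p + 5" p] sq_dist_eq[OF a p, of p]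
      sum.atLeastLessThan_concat[of 0 p "p + 5" "\<lambda>m. (2 * real m + 1) * (ip (cut_power p a) (poly (legendre m)))\<^sup>2"]
    by (simp add: atLeast0LessThan)
  also have "(\<Sum>m\<in>{p..<p + 5}. (2 * real m + 1) * (ip (cut_power p a) (poly (legendre m)))\<^sup>2)
      = (\<Sum>j<5. (2 * (x + real j) + 1) * (R j)\<^sup>2)"
    using sum.shift_bounds_nat_ivl[of "\<lambda>m. (2 * real m + 1) * (ip (cut_power p a) (poly (legendre m)))\<^sup>2" 0 p 5]
    by (simp add: R_def x_def atLeast0LessThan add.commute)
  also have "\<dots> = (2 * x + 1) * (R 0)\<^sup>2 + (2 * x + 3) * (R 1)\<^sup>2 + (2 * x + 5) * (R 2)\<^sup>2
      + (2 * x + 7) * (R 3)\<^sup>2 + (2 * x + 9) * (R 4)\<^sup>2"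
    by (simp add: eval_nat_numeral algebra_simps)
  finally have dist: "sq_dist (p + 5) p a = sq_dist p p a - ((2 * x + 1) * (R 0)\<^sup>2 + (2 * x + 3) * (R 1)\<^sup>2
      + (2 * x + 5) * (R 2)\<^sup>2 + (2 * x + 7) * (R 3)\<^sup>2 + (2 * x + 9) * (R 4)\<^sup>2)" .
  have "sq_dist (p + 5) p a * K\<^sup>2 * (2 * x - 1) = sq_dist p p a * K\<^sup>2 * (2 * x - 1)
      - (2 * x - 1) * ((2 * x + 1) * (K * R 0)\<^sup>2 + (2 * x + 3) * (K * R 1)\<^sup>2 + (2 * x + 5) * (K * R 2)\<^sup>2
      + (2 * x + 7) * (K * R 3)\<^sup>2 + (2 * x + 9) * (K * R 4)\<^sup>2)"
    unfolding dist by (simp add: power_mult_distrib algebra_simps)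
  also have "\<dots> = Z * poly (quintic x) t"
    unfolding base R0 R1 R2 R3 R4 power_mult_distrib[of "t ^ p * _"] power_mult_distrib[of "t ^ p"] tp B2 poly_quintic
    by (simp add: algebra_simps)
  finally show ?thesis
    by (simp add: sq_dist_poly5_def Z_def t_def x_def K_def)
qed

text \<open>Supplies the uniqueness demanded by the definite description in \<open>f_poly5\<close>:
  composition with a nonconstant polynomial is injective.\<close>

lemma poly_eqI_parabola:
  fixes P Q :: "real poly"
  assumes "\<And>a. a \<in> {0..1} \<Longrightarrow> poly P (a\<^sup>2 - a) = poly Q (a\<^sup>2 - a)"
  shows "P = Q"
proof -
  have "(P - Q) \<circ>\<^sub>p parabola = 0"
  proof (rule poly_eqI_01)
    fix a :: real assume "a \<in> {0..1}"
    from assms[OF this] show "poly ((P - Q) \<circ>\<^sub>p parabola) a = poly 0 a"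
      by (simp add: poly_pcompose power2_eq_square algebra_simps)
  qed
  then have "P - Q = 0" by (rule pcompose_eq_0) simp
  then show ?thesis by simp
qed

lemma A_const_5:
  assumes a: "a \<in> {0..1}" and p: "0 < p"
  shows "(A_const (p + 5) 5 a)\<^sup>2 * (fact (p + 2))\<^sup>2 * (2 * real p - 1) = poly (sq_dist_poly5 p) (a\<^sup>2 - a)"
proof -
  have "A_const (p + 5) 5 a = sqrt (sq_dist (p + 5) p a)"
    using A_const_eq_sqrt_sq_dist[OF p _ a, of "p + 5"] by simp
  then show ?thesis
    using sq_dist_5[OF a p] by (simp add: sq_dist_def ip_nonneg)
qed

lemma f_poly5_eq:
  assumes p: "0 < p"
  shows "f_poly5 (p + 5) = sq_dist_poly5 p"
  unfolding f_poly5_def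
proof (rule the_equality)
  have eqs: "p + 5 - 3 = p + 2" "2 * real (p + 5) - 11 = 2 * real p - 1" by simp_all
  show *: "\<forall>a\<in>{0..1}. poly (sq_dist_poly5 p) (a\<^sup>2 - a)
      = (A_const (p + 5) 5 a)\<^sup>2 * (fact (p + 5 - 3))\<^sup>2 * (2 * real (p + 5) - 11)"
    unfolding eqs using A_const_5[OF _ p] by simp
  fix P assume "\<forall>a\<in>{0..1}. poly P (a\<^sup>2 - a)
      = (A_const (p + 5) 5 a)\<^sup>2 * (fact (p + 5 - 3))\<^sup>2 * (2 * real (p + 5) - 11)"
  with * show "P = sq_dist_poly5 p" by (intro poly_eqI_parabola) simp
qed

text \<open>With \<open>X = a\<^sup>2 - a = t\<close>, the derivatives of order 5 of \<open>X ^ (p + 4)\<close> and of order 6 of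
  \<open>X ^ (p + 5)\<close> are, up to constants, \<open>X ^ (p - 1)\<close> times \<open>(2 * a - 1) * poly (quad_factor p) t\<close> and
  \<open>poly (cubic_factor p) t\<close>.\<close>

definition quad_factor :: "real \<Rightarrow> real poly" where
  "quad_factor x = [:x ^ 2 + x,
     8 * x ^ 2 + 28 * x + 20,
     16 * x ^ 2 + 96 * x + 140:]"

definition cubic_factor :: "real \<Rightarrow> real poly" where
  "cubic_factor x = [:x ^ 3 + 3 * x ^ 2 + 2 * x,
     12 * x ^ 3 + 66 * x ^ 2 + 114 * x + 60,
     48 * x ^ 3 + 384 * x ^ 2 + 996 * x + 840,
     64 * x ^ 3 + 672 * x ^ 2 + 2288 * x + 2520:]"

text \<open>Trades the product of cubic and quadratic for the square of the cubic and
  \<open>t\<close> times the cubic times its derivative, the two ingredients in the derivative of a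
  power of \<open>- t\<close> times the squared cubic.\<close>

lemma cubic_factor_pderiv:
  "3 * poly (cubic_factor x) t = 3 * (x + 2) * poly (quad_factor x) t + t * poly (pderiv (cubic_factor x)) t"
  unfolding cubic_factor_def quad_factor_def by (simp add: pderiv_pCons) algebra

text \<open>Up to sign and a power of \<open>- t\<close>, the left side is the derivative of
  \<open>sq_dist_poly5 p\<close>, so its critical points inside the interval are zeros of the cubic
  or the quadratic.\<close>

lemma quintic_pderiv:
  "(2 * x - 1) * poly (quintic x) t + t * poly (pderiv (quintic x)) t
     = (2 * x - 1) * (x + 2) * poly (cubic_factor x) t * poly (quad_factor x) t"
  unfolding quintic_def cubic_factor_def quad_factor_def by (simp add: pderiv_pCons) algebra

lemma sq_dist_poly5_deriv:
  assumes p: "0 < p"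
  shows "(poly (sq_dist_poly5 p) has_real_derivative
    - ((2 * real p - 1) * (real p + 2) * (- t) ^ (2 * p - 2)
        * (poly (cubic_factor (real p)) t * poly (quad_factor (real p)) t))) (at t)"
proof -
  define M where "M = 2 * p - 2"
  have M: "2 * p - 1 = Suc M" "real M = 2 * real p - 2" using p by (auto simp: M_def)
  have "((\<lambda>t. (- t) ^ Suc M) has_real_derivative (1 + real M) * (-1 * (- t) ^ M)) (at t)"
    by (intro DERIV_power_Suc) (auto intro!: derivative_eq_intros)
  from DERIV_mult[OF this poly_DERIV]
  have "((\<lambda>t. (- t) ^ Suc M * poly (quintic (real p)) t) has_real_derivative
      - (1 + real M) * (- t) ^ M * poly (quintic (real p)) t
      + (- t) ^ Suc M * poly (pderiv (quintic (real p))) t) (at t)"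
    by (rule DERIV_cong) (simp add: algebra_simps)
  moreover have "- (1 + real M) * (- t) ^ M * poly (quintic (real p)) t
      + (- t) ^ Suc M * poly (pderiv (quintic (real p))) t
      = - ((- t) ^ M * ((2 * real p - 1) * poly (quintic (real p)) t + t * poly (pderiv (quintic (real p))) t))"
    unfolding M(2) by (simp add: algebra_simps)
  moreover have "poly (sq_dist_poly5 p) = (\<lambda>t. (- t) ^ Suc M * poly (quintic (real p)) t)"
    unfolding sq_dist_poly5_def M(1) fun_eq_iff by simp
  ultimately show ?thesis
    unfolding quintic_pderiv by (simp add: M_def mult_ac del: minus_mult_left)
qed

text \<open>The majorant \<open>S\<close> is nonincreasing and agrees with the polynomial at the zeros of the cubic, so
  the local maxima decrease towards 0.\<close>

lemma sq_dist_poly5_max: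
  assumes p: "0 < p" and t1: "t1 \<in> {-1/4..0}" and root: "poly (cubic_factor (real p)) t1 = 0"
    and left: "\<And>t. \<lbrakk>-1/4 \<le> t; t \<le> t1\<rbrakk> \<Longrightarrow> poly (cubic_factor (real p)) t \<le> 0 \<and> poly (quad_factor (real p)) t \<ge> 0"
    and t: "t \<in> {-1/4..0}"
  shows "poly (sq_dist_poly5 p) t \<le> poly (sq_dist_poly5 p) t1"
proof (cases "t \<le> t1")
  case True
  show ?thesis
  proof (rule DERIV_nonneg_imp_nondecreasing[OF True])
    fix s assume s: "t \<le> s" "s \<le> t1"
    have h1: "(- s) ^ (2 * p - 2) \<ge> 0" using s t1 by (intro zero_le_power) auto
    have h2: "poly (cubic_factor (real p)) s * poly (quad_factor (real p)) s \<le> 0"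
      using left[of s] s t by (intro mult_nonpos_nonneg) auto
    have h3: "(2 * real p - 1) * (real p + 2) \<ge> 0" using p by simp
    have neg: "((2 * real p - 1) * (real p + 2) * (- s) ^ (2 * p - 2))
        * (poly (cubic_factor (real p)) s * poly (quad_factor (real p)) s) \<le> 0"
      by (rule mult_nonneg_nonpos[OF mult_nonneg_nonneg[OF h3 h1] h2])
    show "\<exists>y. (poly (sq_dist_poly5 p) has_real_derivative y) (at s) \<and> y \<ge> 0"
      by (rule exI, rule conjI, rule sq_dist_poly5_deriv[OF p], use neg in linarith)
  qed
next
  case False
  define x where "x = real p"
  have x: "x \<ge> 1" using p by (simp add: x_def)
  define M where "M = 2 * p - 2"
  have M: "real M = 2 * x - 2" using p by (simp add: M_def x_def)
  let ?c = "poly (cubic_factor x)" and ?c' = "poly (pderiv (cubic_factor x))" and ?q = "poly (quad_factor x)"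
  \<comment> \<open>Sonin's correction. The weight \<open>(2 * x - 1) / 6\<close> is the one for
    which \<open>cubic_factor_pderiv\<close> cancels the terms with \<open>?c s * ?q s\<close> in
    the derivative of \<open>S\<close>, leaving a nonpositive multiple of the squared cubic.\<close>
  define W where "W t = (2 * x - 1) / 6 * ((- t) ^ Suc M * (?c t)\<^sup>2)" for t
  define S where "S t = poly (sq_dist_poly5 p) t + W t" for t
  have W: "W s \<ge> 0" if "s \<le> 0" for s
  proof -
    have "(- s) ^ Suc M \<ge> 0" using that by (intro zero_le_power) simp
    then show ?thesis unfolding W_def using x by (intro mult_nonneg_nonneg) auto
  qed
  have "S t \<le> S t1"
  proof (rule DERIV_nonpos_imp_nonincreasing[of t1 t S])
    show "t1 \<le> t" using False by simp
    fix s assume s: "t1 \<le> s" "s \<le> t"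
    have dW: "(W has_real_derivative (2 * x - 1) / 6 *
        (- (1 + real M) * (- s) ^ M * (?c s)\<^sup>2 + (- s) ^ Suc M * (2 * ?c s * ?c' s))) (at s)"
    proof -
      have d1: "((\<lambda>t. (- t) ^ Suc M) has_real_derivative (1 + real M) * (-1 * (- s) ^ M)) (at s)"
        by (intro DERIV_power_Suc) (auto intro!: derivative_eq_intros)
      have d2: "((\<lambda>t. (?c t)\<^sup>2) has_real_derivative 2 * ?c s * ?c' s) (at s)"
        using DERIV_power[OF poly_DERIV[of "cubic_factor x" s], of 2] by (simp add: mult_ac)
      show ?thesis
        unfolding W_def
        by (rule DERIV_cong[OF DERIV_cmult[OF DERIV_mult[OF d1 d2]]]) (simp add: algebra_simps)
    qed
    have "(S has_real_derivative - ((2 * x - 1) * (x + 2) * (- s) ^ M * (?c s * ?q s)) + (2 * x - 1) / 6 *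
        (- (1 + real M) * (- s) ^ M * (?c s)\<^sup>2 + (- s) ^ Suc M * (2 * ?c s * ?c' s))) (at s)"
      unfolding S_def by (rule DERIV_add[OF sq_dist_poly5_deriv[OF p, folded x_def M_def] dW])
    moreover have "- ((2 * x - 1) * (x + 2) * (- s) ^ M * (?c s * ?q s)) + (2 * x - 1) / 6 *
        (- (1 + real M) * (- s) ^ M * (?c s)\<^sup>2 + (- s) ^ Suc M * (2 * ?c s * ?c' s))
      = - ((2 * x - 1) * ((2 * x - 1) / 6 + 1) * ((- s) ^ M * (?c s)\<^sup>2))"
    proof -
      define Y where "Y = (- s) ^ M"
      have Y: "(- s) ^ Suc M = - s * Y" by (simp add: Y_def)
      show ?thesis
        using cubic_factor_pderiv[of x s] unfolding M Y Y_def[symmetric] by algebra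
    qed
    moreover have "- ((2 * x - 1) * ((2 * x - 1) / 6 + 1) * ((- s) ^ M * (?c s)\<^sup>2)) \<le> 0"
    proof -
      have "(2 * x - 1) * ((2 * x - 1) / 6 + 1) * ((- s) ^ M * (?c s)\<^sup>2) \<ge> 0"
      proof -
        have "(- s) ^ M \<ge> 0" using s t by (intro zero_le_power) simp
        then show ?thesis using x by (intro mult_nonneg_nonneg) auto
      qed
      then show ?thesis by (simp only: neg_le_0_iff_le)
    qed
    ultimately show "\<exists>y. (S has_real_derivative y) (at s) \<and> y \<le> 0" by metis
  qed
  moreover have "W t1 = 0" using root by (simp add: W_def x_def)
  ultimately show ?thesis using W[of t] t by (simp add: S_def)
qed

text \<open>The centre \<open>- (x + 2) / (2 * (2 * x + 9))\<close> is the mean of the three roots,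
  so the square term disappears. The sign of \<open>y\<close> is reversed: the smallest root in
  \<open>t\<close> is the largest in \<open>y\<close>.\<close>

lemma cubic_factor_subst:
  assumes "x \<ge> 1"
  shows "(2 * x + 9)\<^sup>2 * poly (cubic_factor x) (- ((x + 2) / 2 + y) / (2 * x + 9))
    = - 2 * (4 * (2 * x + 5) * (2 * x + 7) * y ^ 3 - 15 * (x + 2) * (2 * x + 5) * y + 5 * (x + 2) * (2 * x - 1))"
proof -
  define t where "t = - ((x + 2) / 2 + y) / (2 * x + 9)"
  have "(2 * x + 9) * t = - ((x + 2) / 2 + y)" using assms by (simp add: t_def)
  then have y: "y = - ((2 * x + 9) * t) - (x + 2) / 2" by simp
  show ?thesis unfolding t_def[symmetric] unfolding y cubic_factor_def by (simp add: field_simps power2_eq_square power3_eq_cube)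
qed

lemma quad_factor_subst:
  assumes "x \<ge> 1"
  shows "(2 * x + 9)\<^sup>2 * poly (quad_factor x) (- ((x + 2) / 2 + y) / (2 * x + 9))
    = 4 * (2 * x + 5) * (2 * x + 7) * y\<^sup>2 + 20 * (2 * x + 5) * y - 5 * (2 * x\<^sup>2 + 13 * x + 8)"
proof -
  define t where "t = - ((x + 2) / 2 + y) / (2 * x + 9)"
  have "(2 * x + 9) * t = - ((x + 2) / 2 + y)" using assms by (simp add: t_def)
  then have y: "y = - ((2 * x + 9) * t) - (x + 2) / 2" by simp
  show ?thesis unfolding t_def[symmetric] unfolding y quad_factor_def by (simp add: field_simps power2_eq_square power3_eq_cube)
qed

section \<open>Location of the maximum\<close>

text \<open>With \<open>t = - ((x + 2) / 2 + y) / (2 * x + 9)\<close> the cubic becomes, up to a negative factor,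
  \<open>4 * y ^ 3 - 3 * w\<^sup>2 * y + w ^ 3 * cos \<phi>\<close>, so the triple angle formula gives its root.\<close>

lemma cubic_factor_smallest_root:
  fixes x \<phi> w :: real
  assumes x: "x \<ge> 1" and \<phi>: "pi / 4 < \<phi>" "\<phi> < pi / 2"
    and w: "w > 0" "w\<^sup>2 = 5 * (x + 2) / (2 * x + 7)"
    and cos\<phi>: "w * cos \<phi> = (2 * x - 1) / (2 * x + 5)"
    and t1: "t1 = - ((x + 2) / 2 + w * cos (\<phi> / 3 - pi / 3)) / (2 * x + 9)"
  shows "t1 \<in> {-1/4..0}" "poly (cubic_factor x) t1 = 0"
    "\<And>t. \<lbrakk>-1/4 \<le> t; t \<le> t1\<rbrakk> \<Longrightarrow> poly (cubic_factor x) t \<le> 0 \<and> poly (quad_factor x) t \<ge> 0"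
proof -
  define y1 where "y1 = w * cos (\<phi> / 3 - pi / 3)"
  define h where "h y = 4 * y ^ 3 - 3 * w\<^sup>2 * y + w\<^sup>2 * ((2 * x - 1) / (2 * x + 5))" for y
  have cub: "(2 * x + 9)\<^sup>2 * poly (cubic_factor x) (- ((x + 2) / 2 + y) / (2 * x + 9))
      = - 2 * ((2 * x + 5) * (2 * x + 7)) * h y" for y
  proof -
    have "(2 * x + 7) * w\<^sup>2 = 5 * (x + 2)" "(2 * x + 5) * ((2 * x - 1) / (2 * x + 5)) = 2 * x - 1"
      using x by (simp_all add: w(2))
    then show ?thesis unfolding cubic_factor_subst[OF x] h_def by algebra
  qed
  \<comment> \<open>From \<open>\<phi> > pi / 4\<close> the angle \<open>pi / 3 - \<phi> / 3\<close>
    lies below \<open>pi / 4\<close>. This puts \<open>y1\<close> at or beyond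
    \<open>w / sqrt 2\<close>, to the right of the local minimum of \<open>h\<close> at
    \<open>w / 2\<close>.\<close>
  have cos_ge: "cos (\<phi> / 3 - pi / 3) \<ge> sqrt 2 / 2"
  proof -
    have "cos (pi / 4) \<le> cos (pi / 3 - \<phi> / 3)"
      using \<phi> by (intro cos_monotone_0_pi_le) auto
    then show ?thesis by (simp add: cos_45 cos_minus[of "pi / 3 - \<phi> / 3", symmetric])
  qed
  moreover have "sqrt 2 / 2 > (0::real)" by simp
  ultimately have "cos (\<phi> / 3 - pi / 3) > 0" by linarith
  then have y1_pos: "y1 > 0" unfolding y1_def using w(1) by simp
  have y1_ge: "2 * y1\<^sup>2 \<ge> w\<^sup>2"
  proof -
    have "(sqrt 2 / 2)\<^sup>2 \<le> (cos (\<phi> / 3 - pi / 3))\<^sup>2" using cos_ge by (intro power_mono) auto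
    then have "w\<^sup>2 * (1 / 2) \<le> w\<^sup>2 * (cos (\<phi> / 3 - pi / 3))\<^sup>2"
      by (intro mult_left_mono) (auto simp: power_divide)
    then show ?thesis by (simp add: y1_def power_mult_distrib)
  qed
  have h_y1: "h y1 = 0"
  proof -
    define z where "z = cos (\<phi> / 3 - pi / 3)"
    \<comment> \<open>Tripling turns the shift by \<open>pi / 3\<close> into a shift by
      \<open>pi\<close>, which produces the sign.\<close>
    have "cos (3 * (\<phi> / 3 - pi / 3)) = - cos \<phi>" by (simp add: right_diff_distrib)
    then have z: "4 * z ^ 3 - 3 * z = - cos \<phi>" by (simp only: z_def cos_treble_cos)
    have "h y1 = w ^ 3 * (4 * z ^ 3 - 3 * z) + w\<^sup>2 * (w * cos \<phi>)"
      unfolding h_def y1_def z_def[symmetric] cos\<phi>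
      by (simp add: power2_eq_square power3_eq_cube algebra_simps)
    then show ?thesis unfolding z by (simp add: power2_eq_square power3_eq_cube)
  qed
  have h_mono: "h y \<le> h y'" if "y0 \<le> y" "y \<le> y'" "y0 > 0" "2 * y0\<^sup>2 \<ge> w\<^sup>2" for y0 y y'
  proof -
    have "y0\<^sup>2 \<le> y\<^sup>2" "y0\<^sup>2 \<le> y'\<^sup>2" using that by (auto intro: power_mono)
    moreover have "y * y' \<ge> 0" "w\<^sup>2 \<ge> 0" using that by simp_all
    ultimately have "4 * (y\<^sup>2 + y * y' + y'\<^sup>2) - 3 * w\<^sup>2 \<ge> 0"
      unfolding distrib_left using that(4) by linarith
    then have "(y' - y) * (4 * (y\<^sup>2 + y * y' + y'\<^sup>2) - 3 * w\<^sup>2) \<ge> 0"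
      using that by (intro mult_nonneg_nonneg) auto
    also have "(y' - y) * (4 * (y\<^sup>2 + y * y' + y'\<^sup>2) - 3 * w\<^sup>2) = h y' - h y"
      by (simp add: h_def power2_eq_square power3_eq_cube algebra_simps)
    finally show ?thesis by simp
  qed
  have t1': "t1 = - ((x + 2) / 2 + y1) / (2 * x + 9)" by (simp add: t1 y1_def)
  \<comment> \<open>The value \<open>y = 5 / 4\<close> corresponds to \<open>t = - 1 / 4\<close>.
    The cubic is negative there, so \<open>h (5 / 4) > 0\<close>, whereas a larger zero
    \<open>y1\<close> would force \<open>h (5 / 4) \<le> 0\<close> by monotonicity.\<close>
  have y1_le: "y1 \<le> 5 / 4"
  proof (rule ccontr)
    assume "\<not> y1 \<le> 5 / 4"
    then have "5 / 4 \<le> y1" by simp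
    moreover have "w\<^sup>2 \<le> 2 * (5 / 4)\<^sup>2"
      unfolding w(2) using x by (simp add: field_simps power2_eq_square)
    ultimately have le: "h (5 / 4) \<le> h y1" by (intro h_mono[of "5 / 4"]) auto
    have "- ((x + 2) / 2 + 5 / 4) / (2 * x + 9) = - 1 / 4"
      using x by (simp add: field_simps)
    moreover have "poly (cubic_factor x) (- 1 / 4) = - 15 / 8"
      by (simp add: cubic_factor_def field_simps power2_eq_square power3_eq_cube)
    ultimately have "(2 * x + 9)\<^sup>2 * (- 15 / 8) = - 2 * ((2 * x + 5) * (2 * x + 7) * h (5 / 4))"
      using cub[of "5 / 4"] by (simp only: mult.assoc)
    moreover have "(2 * x + 9)\<^sup>2 > 0" using x by simp
    ultimately have "(2 * x + 5) * (2 * x + 7) * h (5 / 4) > 0" by linarith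
    moreover have "(2 * x + 5) * (2 * x + 7) > 0" using x by simp
    ultimately have "h (5 / 4) > 0" by (rule zero_less_mult_pos)
    with le h_y1 show False by simp
  qed
  show "t1 \<in> {-1/4..0}"
    unfolding t1' using y1_le y1_pos x by (simp add: field_simps)
  have x9: "2 * x + 9 \<noteq> 0" using x by simp
  show "poly (cubic_factor x) t1 = 0"
    using cub[of y1] h_y1 x9 unfolding t1' by simp
  fix t assume t: "-1/4 \<le> t" "t \<le> t1"
  define y where "y = - ((2 * x + 9) * t) - (x + 2) / 2"
  have ty: "t = - ((x + 2) / 2 + y) / (2 * x + 9)" using x9 by (simp add: y_def field_simps)
  have "y1 \<le> y"
    using t(2) x unfolding t1' ty by (simp add: divide_le_cancel)
  then have "h y \<ge> 0" using h_mono[of y1 y1 y] y1_ge y1_pos h_y1 by simp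
  then have "(2 * x + 9)\<^sup>2 * poly (cubic_factor x) t \<le> 0"
    using cub[of y] x unfolding ty by simp
  then have "poly (cubic_factor x) t \<le> 0" using x9 by (simp add: mult_le_0_iff)
  \<comment> \<open>By \<open>2 * y\<^sup>2 \<ge> w\<^sup>2\<close> the square term in
    \<open>quad_factor_subst\<close> is at least \<open>10 * (2 * x + 5) * (x + 2)\<close>, which
    outweighs the negative constant term.\<close>
  moreover have "poly (quad_factor x) t \<ge> 0"
  proof -
    have "y1\<^sup>2 \<le> y\<^sup>2" using \<open>y1 \<le> y\<close> y1_pos by (intro power_mono) auto
    then have "w\<^sup>2 \<le> 2 * y\<^sup>2" using y1_ge by simp
    then have "5 * (x + 2) \<le> 2 * (2 * x + 7) * y\<^sup>2"
      unfolding w(2) using x by (simp add: field_simps)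
    then have "2 * (2 * x + 5) * (2 * (2 * x + 7) * y\<^sup>2 - 5 * (x + 2)) \<ge> 0"
      using x by (intro mult_nonneg_nonneg) auto
    then have "10 * (2 * x + 5) * (x + 2) \<le> 4 * (2 * x + 5) * (2 * x + 7) * y\<^sup>2"
      by (simp add: algebra_simps)
    moreover have "20 * (2 * x + 5) * y \<ge> 0" using x y1_pos \<open>y1 \<le> y\<close> by simp
    moreover have "10 * (2 * x + 5) * (x + 2) - 5 * (2 * x\<^sup>2 + 13 * x + 8) \<ge> 0"
      using x by (simp add: algebra_simps power2_eq_square)
    ultimately have "(2 * x + 9)\<^sup>2 * poly (quad_factor x) t \<ge> 0"
      unfolding ty quad_factor_subst[OF x] by linarith
    then show ?thesis using x9 by (simp add: zero_le_mult_iff)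
  qed
  ultimately show "poly (cubic_factor x) t \<le> 0 \<and> poly (quad_factor x) t \<ge> 0" by simp
qed

theorem mainTheorem8:
  fixes n :: nat and \<phi> t1 :: real
  assumes "n \<ge> 6"
    and "pi / 4 < \<phi>" and "\<phi> < pi / 2"
    and "cos \<phi> = (2 * real n - 11) / (2 * real n - 5) *
                   (sqrt (2 * real n - 3) / sqrt (5 * (real n - 3)))"
    and "t1 = - (real n - 3) / (2 * (2 * real n - 1))
              - sqrt (5 * (real n - 3)) / ((2 * real n - 1) * sqrt (2 * real n - 3))
                * cos (\<phi> / 3 - pi / 3)"
  shows "is_arg_max (poly (f_poly5 n)) (\<lambda>t. t \<in> {-1/4..0}) t1 \<and>
         (\<exists>F :: real \<Rightarrow> real.
            (\<forall>a\<in>{0..1}. F (a\<^sup>2 - a) = (A_const n 5 a)\<^sup>2) \<and>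
            is_arg_max F (\<lambda>t. t \<in> {-1/4..0}) t1)"
proof -
  define p where "p = n - 5"
  have p: "0 < p" and n: "n = p + 5" using assms(1) by (auto simp: p_def)
  define x where "x = real p"
  have x: "x \<ge> 1" and rn: "real n = x + 5" using p by (auto simp: x_def n)
  \<comment> \<open>The scale at which the linear coefficient of the depressed cubic, after
    division, becomes \<open>- 3 * w\<^sup>2\<close>, as the triple angle formula requires.\<close>
  define w where "w = sqrt (5 * (x + 2)) / sqrt (2 * x + 7)"
  have w: "w > 0" "w\<^sup>2 = 5 * (x + 2) / (2 * x + 7)"
    using x by (auto simp: w_def power_divide)
  have "cos \<phi> = (2 * x - 1) / (2 * x + 5) * (sqrt (2 * x + 7) / sqrt (5 * (x + 2)))"
    using assms(4) by (simp add: rn add.commute)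
  moreover have "sqrt (2 * x + 7) \<noteq> 0" "sqrt (5 * (x + 2)) \<noteq> 0" using x by simp_all
  ultimately have "w * cos \<phi> = (2 * x - 1) / (2 * x + 5)"
    by (simp add: w_def del: real_sqrt_eq_0_iff)
  moreover have "t1 = - ((x + 2) / 2 + w * cos (\<phi> / 3 - pi / 3)) / (2 * x + 9)"
  proof -
    have "- u / (2 * d) - r / (d * s) * C = - (u / 2 + r / s * C) / d"
      if "d \<noteq> 0" "s \<noteq> 0" for u d r s C :: real
      using that by (simp add: field_simps)
    from this[of "2 * x + 9" "sqrt (2 * x + 7)" "x + 2" "sqrt (5 * (x + 2))" "cos (\<phi> / 3 - pi / 3)"]
    have "- (x + 2) / (2 * (2 * x + 9)) - sqrt (5 * (x + 2)) / ((2 * x + 9) * sqrt (2 * x + 7)) * cos (\<phi> / 3 - pi / 3)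
        = - ((x + 2) / 2 + w * cos (\<phi> / 3 - pi / 3)) / (2 * x + 9)"
      using x by (simp only: w_def) simp
    moreover have "real n - 3 = x + 2" "2 * real n - 1 = 2 * x + 9" "2 * real n - 3 = 2 * x + 7"
      by (simp_all add: rn)
    ultimately show ?thesis unfolding assms(5) by (simp only:)
  qed
  ultimately have root: "t1 \<in> {-1/4..0}" "poly (cubic_factor x) t1 = 0"
    "\<And>t. \<lbrakk>-1/4 \<le> t; t \<le> t1\<rbrakk> \<Longrightarrow> poly (cubic_factor x) t \<le> 0 \<and> poly (quad_factor x) t \<ge> 0"
    using cubic_factor_smallest_root[OF x assms(2,3) w] by blast+
  have f: "f_poly5 n = sq_dist_poly5 p" unfolding n by (rule f_poly5_eq[OF p])
  have max: "poly (f_poly5 n) t \<le> poly (f_poly5 n) t1" if "t \<in> {-1/4..0}" for t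
    unfolding f using sq_dist_poly5_max[OF p root[unfolded x_def] that] .
  define c where "c = (fact (p + 2))\<^sup>2 * (2 * x - 1)"
  have c: "c > 0" using x by (simp add: c_def)
  define F where "F t = poly (f_poly5 n) t / c" for t
  have "F (a\<^sup>2 - a) = (A_const n 5 a)\<^sup>2" if "a \<in> {0..1}" for a
  proof -
    have "poly (f_poly5 n) (a\<^sup>2 - a) = (A_const n 5 a)\<^sup>2 * c"
      unfolding f using A_const_5[OF that p, folded n] by (simp only: c_def x_def mult.assoc)
    then show ?thesis using c by (simp add: F_def)
  qed
  moreover have "is_arg_max F (\<lambda>t. t \<in> {-1/4..0}) t1"
    using root(1) max c by (auto simp: is_arg_max_linorder F_def intro: divide_right_mono)
  moreover have "is_arg_max (poly (f_poly5 n)) (\<lambda>t. t \<in> {-1/4..0}) t1"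
    using root(1) max by (auto simp: is_arg_max_linorder)
  ultimately show ?thesis by blast
qed

end
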